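(* The Birkhoff polytope $B_p$ has non-regular triangulations for $p\ge4$, and all triangulations of $B_p$ are regular for $p<4$.
   Context: The $p$th Birkhoff polytope $B_p$ is the set of $p\times p$ real matrices with non-negative entries whose rows and columns all sum to $1$; its vertices are the permutation matrices. A triangulation of a polytope is a simplicial complex of simplices with vertices among the vertices of the polytope, covering the polytope, in which any two simplices meet in a common face. A triangulation of a point set $A$ is regular if it is the projection of the lower envelope of $\mathrm{conv}\{(a,w(a)):a\in A\}$ for some function $w:A\to\mathbb{R}$. *)

theory Defs
  imports "HOL-Analysis.Analysis"
begin

definition birkhoff_polytope :: "(real ^ 'p ^ 'p) set" where
  "birkhoff_polytope = {M. (\<forall>i j. 0 \<le> M $ i $ j) \<and>
     (\<forall>i. (\<Sum>j\<in>UNIV. M $ i $ j) = 1) \<and> (\<forall>j. (\<Sum>i\<in>UNIV. M $ i $ j) = 1)}"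

definition vertices_of :: "'a::real_vector set \<Rightarrow> 'a set" where
  "vertices_of P = {v. v extreme_point_of P}"

text \<open>A complex is the set of all its cells, of every dimension. By \<^const>\<open>simplicial_complex\<close> it is
  closed under faces, so it contains the empty face.\<close>

definition polytope_triangulation :: "'a::euclidean_space set \<Rightarrow> 'a set set \<Rightarrow> bool" where
  "polytope_triangulation P \<T> \<longleftrightarrow>
     simplicial_complex \<T> \<and> (\<forall>S\<in>\<T>. vertices_of S \<subseteq> vertices_of P) \<and> \<Union>\<T> = P"

definition lifted_polytope :: "'a::euclidean_space set \<Rightarrow> ('a \<Rightarrow> real) \<Rightarrow> ('a \<times> real) set" where
  "lifted_polytope A w = convex hull ((\<lambda>a. (a, w a)) ` A)"

definition lower_envelope :: "('a \<times> real) set \<Rightarrow> ('a \<times> real) set" where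
  "lower_envelope Q = {(x, t). (x, t) \<in> Q \<and> (\<forall>s. (x, s) \<in> Q \<longrightarrow> t \<le> s)}"

text \<open>The lower envelope is itself a polyhedral complex, whose cells are the faces of the lifted
  polytope lying in it. These cells are what is projected; they include the empty face, in
  accordance with the convention for \<^const>\<open>simplicial_complex\<close>.\<close>

definition projected_lower_envelope :: "'a::euclidean_space set \<Rightarrow> ('a \<Rightarrow> real) \<Rightarrow> 'a set set" where
  "projected_lower_envelope A w =
     {fst ` F | F. F face_of lifted_polytope A w \<and> F \<subseteq> lower_envelope (lifted_polytope A w)}"

definition regular_over :: "'a::euclidean_space set \<Rightarrow> 'a set set \<Rightarrow> bool" where
  "regular_over A \<T> \<longleftrightarrow> (\<exists>w. \<T> = projected_lower_envelope A w)"

definition regular_triangulation :: "'a::euclidean_space set \<Rightarrow> 'a set set \<Rightarrow> bool" where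
  "regular_triangulation P \<T> \<longleftrightarrow> polytope_triangulation P \<T> \<and> regular_over (vertices_of P) \<T>"

end

theory Submission
  imports Defs
begin

text \<open>A triangulation of \<open>P = conv V\<close> amounts to a down-closed family of subsets of \<open>V\<close> such that every point of
  \<open>P\<close> has exactly one system of barycentric coordinates with support in the family. By the placing
  construction such a family on a subset of \<open>V\<close> extends to all of \<open>V\<close>. So in size at least 4 it is enough to find
  a non-regular triangulation of the convex hull of a few permutation matrices.

  Eleven of the matrices of \<open>S\<^sub>4\<close> do, with the remaining rows and columns fixed. Write a permutation as
  the list of its values and let
  \<open>x\<^sup>+ = 2431, x\<^sup>- = 2341, y\<^sup>+ = 3412, y\<^sup>- = 3214, z\<^sup>+ = 4132, z\<^sup>- = 4123, a = 1342, b = 1234, c = 1423,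
  p = 1243, q = 1324\<close>. Their affine dependencies are generated by \<open>x\<^sup>+ + p + q = x\<^sup>- + b + c\<close> and its
  analogues for \<open>y\<close> and \<open>z\<close>. Maximising the coefficient of \<open>p\<close> leaves ambiguous just the three circuits
  \<open>y\<^sup>+ + z\<^sup>- + b = y\<^sup>- + z\<^sup>+ + c\<close>, \<open>z\<^sup>+ + x\<^sup>- + c = z\<^sup>- + x\<^sup>+ + a\<close> and \<open>x\<^sup>+ + y\<^sup>- + a = x\<^sup>- + y\<^sup>+ + b\<close>, in three
  different cells, and each may be resolved independently. If every left-hand side is a cell, a weight
  function inducing the triangulation would be smaller on each left-hand side than on the right-hand side,
  although both sides use the same nine matrices in total.

  In size 3 the six vertices have a single dependency, between the even and the odd permutations, and a
  triangulation is determined by which of the two triangles is a cell; in size 1 or 2 the polytope is a simplex.\<close>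

section \<open>Triangulations as families of supports\<close>

text \<open>Coordinates are total functions that vanish off \<open>A\<close>. Hence equality of
  coordinates is equality of functions, and the support \<open>{v. l v \<noteq> 0}\<close> makes
  sense without mentioning \<open>A\<close>.\<close>

definition barycentric :: "'a::real_vector set \<Rightarrow> 'a \<Rightarrow> ('a \<Rightarrow> real) \<Rightarrow> bool" where
  "barycentric A x l \<longleftrightarrow>
     (\<forall>v. 0 \<le> l v) \<and> {v. l v \<noteq> 0} \<subseteq> A \<and> sum l A = 1 \<and> (\<Sum>v\<in>A. l v *\<^sub>R v) = x"

lemma barycentric_superset:
  assumes "finite B" "A \<subseteq> B" "{v. l v \<noteq> 0} \<subseteq> A"
  shows "barycentric A x l \<longleftrightarrow> barycentric B x l"
proof -
  have "sum l B = sum l A" "(\<Sum>v\<in>B. l v *\<^sub>R v) = (\<Sum>v\<in>A. l v *\<^sub>R v)"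
    using assms by (auto intro!: sum.mono_neutral_right)
  then show ?thesis
    using assms by (auto simp: barycentric_def)
qed

lemma barycentric_mono: "finite B \<Longrightarrow> A \<subseteq> B \<Longrightarrow> barycentric A x l \<Longrightarrow> barycentric B x l"
  using barycentric_superset[of B A l x] by (auto simp: barycentric_def)

lemma convex_hull_barycentric:
  assumes "finite A"
  shows "x \<in> convex hull A \<longleftrightarrow> (\<exists>l. barycentric A x l)"
proof
  assume "x \<in> convex hull A"
  then obtain u where u: "\<forall>v\<in>A. 0 \<le> u v" "sum u A = 1" "(\<Sum>v\<in>A. u v *\<^sub>R v) = x"
    using assms by (auto simp: convex_hull_finite)
  have "barycentric A x (\<lambda>v. if v \<in> A then u v else 0)"
    using u by (auto simp: barycentric_def if_distrib[of "\<lambda>c. c *\<^sub>R _"] cong: if_cong sum.cong)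
  then show "\<exists>l. barycentric A x l" by blast
next
  assume "\<exists>l. barycentric A x l"
  then show "x \<in> convex hull A"
    using assms by (auto simp: barycentric_def convex_hull_finite)
qed

lemma convex_hull_barycentric_subset:
  assumes "finite A" "W \<subseteq> A"
  shows "x \<in> convex hull W \<longleftrightarrow> (\<exists>l. barycentric A x l \<and> {v. l v \<noteq> 0} \<subseteq> W)"
proof -
  have "barycentric W x l \<longleftrightarrow> barycentric A x l \<and> {v. l v \<noteq> 0} \<subseteq> W" for l
    using barycentric_superset[OF assms, of l x] by (auto simp: barycentric_def)
  then show ?thesis
    using convex_hull_barycentric[OF finite_subset[OF assms(2,1)], of x] by simp
qed

lemma barycentric_convex_comb:
  assumes "barycentric A x l" "barycentric A y m" "0 \<le> t" "t \<le> 1"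
  shows "barycentric A ((1 - t) *\<^sub>R x + t *\<^sub>R y) (\<lambda>v. (1 - t) * l v + t * m v)"
proof -
  have "(\<Sum>v\<in>A. (1 - t) * l v + t * m v) = (1 - t) * sum l A + t * sum m A"
    by (simp add: sum.distrib sum_distrib_left)
  moreover have "(\<Sum>v\<in>A. ((1 - t) * l v + t * m v) *\<^sub>R v)
      = (1 - t) *\<^sub>R (\<Sum>v\<in>A. l v *\<^sub>R v) + t *\<^sub>R (\<Sum>v\<in>A. m v *\<^sub>R v)"
    by (simp add: sum.distrib scaleR_sum_right scaleR_add_left)
  moreover have "{v. (1 - t) * l v + t * m v \<noteq> 0} \<subseteq> {v. l v \<noteq> 0} \<union> {v. m v \<noteq> 0}"
    by auto
  then have "{v. (1 - t) * l v + t * m v \<noteq> 0} \<subseteq> A"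
    using assms by (auto simp: barycentric_def)
  ultimately show ?thesis
    using assms by (simp add: barycentric_def)
qed

lemma barycentric_uniform:
  assumes "finite A" "W \<subseteq> A" "W \<noteq> {}"
  shows "barycentric A ((\<Sum>v\<in>W. v) /\<^sub>R card W) (\<lambda>v. if v \<in> W then 1 / card W else 0)"
proof -
  have fin: "finite W" "card W > 0"
    using assms by (auto simp: card_gt_0_iff intro: finite_subset)
  have "barycentric W ((\<Sum>v\<in>W. v) /\<^sub>R card W) (\<lambda>v. if v \<in> W then 1 / card W else 0)"
    using fin by (auto simp: barycentric_def scaleR_sum_right inverse_eq_divide)
  then show ?thesis
    using assms barycentric_mono by blast
qed

lemma barycentric_vertex:
  assumes "finite A" "a \<in> A"
  shows "barycentric A a (\<lambda>v. if v = a then 1 else 0)"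
proof -
  have "barycentric A ((\<Sum>v\<in>{a}. v) /\<^sub>R card {a}) (\<lambda>v. if v \<in> {a} then 1 / card {a} else 0)"
    using assms by (intro barycentric_uniform) auto
  then show ?thesis
    by (simp cong: if_cong)
qed

lemma barycentric_insert:
  assumes "finite A" "p \<notin> A" "barycentric A y l" "0 \<le> s" "s \<le> 1"
  shows "barycentric (insert p A) ((1 - s) *\<^sub>R y + s *\<^sub>R p) (\<lambda>v. if v = p then s else (1 - s) * l v)"
proof -
  have lp: "l p = 0" using assms(2,3) by (auto simp: barycentric_def)
  have "barycentric (insert p A) y l" "barycentric (insert p A) p (\<lambda>v. if v = p then 1 else 0)"
    using assms barycentric_mono[of "insert p A" A y l] barycentric_vertex[of "insert p A" p] by auto
  from barycentric_convex_comb[OF this assms(4,5)] 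
  show ?thesis
    by (rule back_subst[where P = "barycentric _ _"]) (auto simp: lp)
qed

text \<open>Unless all weight sits at \<open>p\<close>, the remaining weights can be divided by
  \<open>1 - l p\<close>. They then describe the point \<open>y\<close> of the hull of
  \<open>A\<close> such that \<open>x\<close> lies on the segment from \<open>y\<close> to
  \<open>p\<close>.\<close>

lemma barycentric_insertE:
  assumes "finite A" "p \<notin> A" "barycentric (insert p A) x l"
  obtains "l p = 1" "x = p" "\<And>v. v \<noteq> p \<Longrightarrow> l v = 0"
  | m y where "0 \<le> l p" "l p < 1" "barycentric A y m" "x = (1 - l p) *\<^sub>R y + l p *\<^sub>R p"
      "\<And>v. v \<noteq> p \<Longrightarrow> l v = (1 - l p) * m v" "{v. m v \<noteq> 0} = {v. l v \<noteq> 0} - {p}"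
proof -
  have l: "\<And>v. 0 \<le> l v" "{v. l v \<noteq> 0} \<subseteq> insert p A" "l p + sum l A = 1" "l p *\<^sub>R p + (\<Sum>v\<in>A. l v *\<^sub>R v) = x"
    using assms by (auto simp: barycentric_def)
  show ?thesis
  proof (cases "l p = 1")
    case True
    then have "\<forall>v\<in>A. l v = 0"
      using l(1,3) assms(1) by (simp add: sum_nonneg_eq_0_iff)
    then have "l v = 0" if "v \<noteq> p" for v
      using that l(2) by blast
    moreover have "x = p"
      using True l(4) \<open>\<forall>v\<in>A. l v = 0\<close> by simp
    ultimately show ?thesis using that(1) True by blast
  next
    case False
    have "l p \<le> 1"
      using l(3) sum_nonneg[of A l] l(1) by simp
    then have lt: "l p < 1" using False by simp
    define m where "m = (\<lambda>v. if v = p then 0 else l v / (1 - l p))"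
    define y where "y = (\<Sum>v\<in>A. m v *\<^sub>R v)"
    have "sum m A = sum l A / (1 - l p)"
      unfolding m_def sum_divide_distrib using assms(2) by (intro sum.cong) auto
    then have "sum m A = 1" using l(3) lt by simp
    then have m: "barycentric A y m"
      using l(1,2) lt by (auto simp: barycentric_def y_def m_def)
    have lm: "l v = (1 - l p) * m v" if "v \<noteq> p" for v
      using that lt by (simp add: m_def)
    have "(1 - l p) *\<^sub>R y = (\<Sum>v\<in>A. l v *\<^sub>R v)"
      unfolding y_def scaleR_sum_right scaleR_scaleR
    proof (rule sum.cong)
      show "((1 - l p) * m v) *\<^sub>R v = l v *\<^sub>R v" if "v \<in> A" for v
        using lm[of v] that assms(2) by metis
    qed simp
    then have "x = (1 - l p) *\<^sub>R y + l p *\<^sub>R p" using l(4) by (simp add: add.commute)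
    moreover have "{v. m v \<noteq> 0} = {v. l v \<noteq> 0} - {p}"
      using lt by (auto simp: m_def)
    ultimately show ?thesis
      using that(2) l(1) lt m lm by blast
  qed
qed



text \<open>Deleting an extreme point from a convex set leaves a convex set, which contains
  \<open>A\<close> and hence its hull.\<close>

lemma vertices_not_in_hull:
  assumes "convex P" "a \<in> vertices_of P" "A \<subseteq> P" "a \<notin> A"
  shows "a \<notin> convex hull A"
proof -
  have "convex (P - {a})"
    using assms by (simp add: vertices_of_def extreme_point_of_stillconvex)
  then show ?thesis
    using hull_minimal[of A "P - {a}" convex] assms(3,4) by blast
qed

text \<open>If \<open>a\<close> carried weight less than 1, solving for the remaining part would put
  \<open>a\<close> itself into the hull of the other vertices.\<close>

lemma barycentric_vertex_unique:
  assumes "finite (vertices_of P)" "convex hull vertices_of P = P" "a \<in> vertices_of P"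
    and k: "barycentric (vertices_of P) a k"
  shows "k = (\<lambda>v. if v = a then 1 else 0)"
proof -
  let ?A = "vertices_of P - {a}"
  have A: "finite ?A" "a \<notin> ?A" "insert a ?A = vertices_of P"
    using assms by auto
  have "?A \<subseteq> P"
    by (auto simp: vertices_of_def extreme_point_of_def)
  moreover have "convex P"
    using assms(2) convex_convex_hull by metis
  ultimately have a: "a \<notin> convex hull ?A"
    using assms by (intro vertices_not_in_hull) auto
  have "barycentric (insert a ?A) a k"
    using k A(3) by simp
  with A(1,2) show ?thesis
  proof (cases rule: barycentric_insertE)
    case 1
    then show ?thesis by auto
  next
    case (2 m y)
    then have "(1 - k a) *\<^sub>R a = (1 - k a) *\<^sub>R y"
      by (simp add: algebra_simps)
    then have "a = y" using 2(2) by simp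
    then show ?thesis
      using 2(3) a convex_hull_barycentric[OF A(1)] by blast
  qed
qed

text \<open>The difference of two coordinate systems of one point is an affine dependency.
  Conversely, a small multiple of a dependency can be added to the uniform coordinates of the
  centroid without losing nonnegativity, which gives a second system.\<close>

lemma affine_independent_barycentric:
  assumes "finite A"
  shows "\<not> affine_dependent A \<longleftrightarrow>
    (\<forall>x l m. barycentric A x l \<longrightarrow> barycentric A x m \<longrightarrow> l = m)"
proof
  assume indep: "\<not> affine_dependent A"
  show "\<forall>x l m. barycentric A x l \<longrightarrow> barycentric A x m \<longrightarrow> l = m"
  proof (intro allI impI)
    fix x l m
    assume l: "barycentric A x l" and m: "barycentric A x m"
    have "sum (\<lambda>v. l v - m v) A = 0" "(\<Sum>v\<in>A. (l v - m v) *\<^sub>R v) = 0"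
      using l m by (auto simp: barycentric_def sum_subtractf scaleR_diff_left)
    then have eq: "\<forall>v\<in>A. l v = m v"
      using indep assms unfolding affine_dependent_explicit_finite[OF assms]
      by (metis eq_iff_diff_eq_0)
    have "l v = m v" for v
    proof (cases "v \<in> A")
      case False
      then have "l v = 0" "m v = 0"
        using l m unfolding barycentric_def by blast+
      then show ?thesis by simp
    qed (use eq in blast)
    then show "l = m" by blast
  qed
next
  assume unique: "\<forall>x l m. barycentric A x l \<longrightarrow> barycentric A x m \<longrightarrow> l = m"
  show "\<not> affine_dependent A"
  proof
    assume "affine_dependent A"
    then obtain u where u: "sum u A = 0" "\<exists>v\<in>A. u v \<noteq> 0" "(\<Sum>v\<in>A. u v *\<^sub>R v) = 0"
      by (auto simp: affine_dependent_explicit_finite[OF assms])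
    define n where "n = real (card A)"
    define M where "M = Max ((\<lambda>v. \<bar>u v\<bar>) ` A)"
    have ne: "A \<noteq> {}" using u(2) by auto
    have n: "n > 0" using ne assms by (auto simp: n_def card_gt_0_iff)
    have M: "\<bar>u v\<bar> \<le> M" if "v \<in> A" for v
      using that assms by (auto simp: M_def)
    have M0: "M > 0" using u(2) M by force
    \<comment> \<open>\<open>M\<close> bounds all entries of \<open>u\<close>, so after division by
      \<open>n * M\<close> the perturbation stays within the uniform weight
      \<open>1 / n\<close>.\<close>
    define d where "d = (\<lambda>v. if v \<in> A then u v / (n * M) else 0)"
    define l where "l = (\<lambda>v. if v \<in> A then 1 / n else (0::real))"
    have lb: "barycentric A ((\<Sum>v\<in>A. v) /\<^sub>R card A) l"
      using barycentric_uniform[OF assms subset_refl ne] unfolding l_def n_def by simp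
    have le: "\<bar>d v\<bar> \<le> l v" for v
      using M[of v] M0 n by (auto simp: d_def l_def field_simps abs_mult)
    have "sum d A = (\<Sum>v\<in>A. u v) / (n * M)"
      unfolding d_def sum_divide_distrib by (rule sum.cong) auto
    moreover have "(\<Sum>v\<in>A. d v *\<^sub>R v) = (1 / (n * M)) *\<^sub>R (\<Sum>v\<in>A. u v *\<^sub>R v)"
      unfolding d_def scaleR_sum_right by (rule sum.cong) auto
    ultimately have d0: "sum d A = 0" "(\<Sum>v\<in>A. d v *\<^sub>R v) = 0"
      using u by auto
    have "barycentric A ((\<Sum>v\<in>A. v) /\<^sub>R card A) (\<lambda>v. l v + d v)"
    proof -
      have "0 \<le> l v + d v" for v using le[of v] by linarith
      moreover have "{v. l v + d v \<noteq> 0} \<subseteq> A" by (auto simp: l_def d_def)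
      ultimately show ?thesis
        using lb d0 by (auto simp: barycentric_def sum.distrib scaleR_add_left)
    qed
    then have "l = (\<lambda>v. l v + d v)" using lb unique by blast
    then have "d v = 0" for v by (metis add_cancel_left_right)
    then have "u v = 0" if "v \<in> A" for v
      using that n M0 by (metis d_def divide_eq_0_iff mult_eq_0_iff less_irrefl)
    then show False using u(2) by blast
  qed
qed

text \<open>The abstract complex of the vertex sets of cells. Existence of coordinates expresses
  that the cells cover the hull; uniqueness replaces both the affine independence of each cell and
  the condition on intersections.\<close>

definition triangulating :: "'a::real_vector set \<Rightarrow> 'a set set \<Rightarrow> bool" where
  "triangulating A \<S> \<longleftrightarrow> \<S> \<subseteq> Pow A \<and> {} \<in> \<S> \<and> (\<forall>W\<in>\<S>. \<forall>U\<subseteq>W. U \<in> \<S>) \<and>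
     (\<forall>x\<in>convex hull A. \<exists>!l. barycentric A x l \<and> {v. l v \<noteq> 0} \<in> \<S>)"

lemma triangulatingI:
  assumes "finite A" "\<S> \<subseteq> Pow A" "{} \<in> \<S>" "\<And>W U. W \<in> \<S> \<Longrightarrow> U \<subseteq> W \<Longrightarrow> U \<in> \<S>"
    and "\<And>x l. barycentric A x l \<Longrightarrow> \<exists>m. barycentric A x m \<and> {v. m v \<noteq> 0} \<in> \<S>"
    and "\<And>x l m. barycentric A x l \<Longrightarrow> barycentric A x m \<Longrightarrow> {v. l v \<noteq> 0} \<in> \<S> \<Longrightarrow>
      {v. m v \<noteq> 0} \<in> \<S> \<Longrightarrow> l = m"
  shows "triangulating A \<S>"
  unfolding triangulating_def
proof (intro conjI ballI allI impI)
  fix x assume "x \<in> convex hull A"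
  then obtain l where "barycentric A x l"
    using convex_hull_barycentric[OF assms(1)] by blast
  then obtain m where m: "barycentric A x m" "{v. m v \<noteq> 0} \<in> \<S>"
    using assms(5) by blast
  show "\<exists>!l. barycentric A x l \<and> {v. l v \<noteq> 0} \<in> \<S>"
  proof (rule ex1I)
    show "barycentric A x m \<and> {v. m v \<noteq> 0} \<in> \<S>"
      using m by blast
    show "l = m" if "barycentric A x l \<and> {v. l v \<noteq> 0} \<in> \<S>" for l
      using that m by (intro assms(6)) auto
  qed
qed (use assms(2-4) in auto)

lemma triangulating_exists:
  assumes "triangulating A \<S>" "x \<in> convex hull A"
  obtains l where "barycentric A x l" "{v. l v \<noteq> 0} \<in> \<S>"
proof -
  have "\<exists>!l. barycentric A x l \<and> {v. l v \<noteq> 0} \<in> \<S>"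
    using assms(1) unfolding triangulating_def by (elim conjE) (erule bspec[OF _ assms(2)])
  then show ?thesis
    using that by (metis (no_types, lifting))
qed

lemma triangulating_unique:
  assumes "triangulating A \<S>" "finite A" "barycentric A x l" "barycentric A x m"
    "{v. l v \<noteq> 0} \<in> \<S>" "{v. m v \<noteq> 0} \<in> \<S>"
  shows "l = m"
proof -
  have "x \<in> convex hull A"
    using assms convex_hull_barycentric by blast
  then have "\<exists>!l. barycentric A x l \<and> {v. l v \<noteq> 0} \<in> \<S>"
    using assms(1) unfolding triangulating_def by (elim conjE) (erule bspec)
  then show ?thesis
    using assms(3-6) by (metis (no_types, lifting))
qed

section \<open>From families of supports to simplicial complexes\<close>

lemma triangulating_subset:
  "triangulating A \<S> \<Longrightarrow> W \<in> \<S> \<Longrightarrow> U \<subseteq> W \<Longrightarrow> U \<in> \<S>"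
  "triangulating A \<S> \<Longrightarrow> W \<in> \<S> \<Longrightarrow> W \<subseteq> A"
  unfolding triangulating_def by blast+

lemma triangulating_affine_independent:
  assumes "triangulating A \<S>" "finite A" "W \<in> \<S>"
  shows "\<not> affine_dependent W"
proof -
  have W: "W \<subseteq> A" "finite W"
    using triangulating_subset(2)[OF assms(1,3)] finite_subset[OF _ assms(2)] by auto
  have "l = m" if "barycentric W x l" "barycentric W x m" for x l m
  proof -
    have "{v. l v \<noteq> 0} \<subseteq> W" "{v. m v \<noteq> 0} \<subseteq> W"
      using that unfolding barycentric_def by blast+
    then show ?thesis
      using that assms W barycentric_mono[OF assms(2) W(1)]
      by (intro triangulating_unique[OF assms(1,2)] triangulating_subset(1)[OF assms(1,3)]) auto
  qed
  then show ?thesis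
    using affine_independent_barycentric[OF W(2)] by blast
qed

text \<open>A common point has coordinates supported in \<open>W\<close> and coordinates supported
  in \<open>W'\<close>. Both supports belong to the family, so the coordinates coincide and are
  supported in \<open>W \<inter> W'\<close>.\<close>

lemma triangulating_Int:
  assumes "triangulating A \<S>" "finite A" "W \<in> \<S>" "W' \<in> \<S>"
  shows "convex hull W \<inter> convex hull W' = convex hull (W \<inter> W')"
proof
  show "convex hull (W \<inter> W') \<subseteq> convex hull W \<inter> convex hull W'"
    by (simp add: hull_mono)
  have sub: "W \<subseteq> A" "W' \<subseteq> A"
    using triangulating_subset(2)[OF assms(1)] assms(3,4) by auto
  show "convex hull W \<inter> convex hull W' \<subseteq> convex hull (W \<inter> W')"
  proof
    fix x assume "x \<in> convex hull W \<inter> convex hull W'"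
    then obtain l m where lm: "barycentric A x l" "{v. l v \<noteq> 0} \<subseteq> W" "barycentric A x m" "{v. m v \<noteq> 0} \<subseteq> W'"
      using convex_hull_barycentric_subset[OF \<open>finite A\<close> sub(1)]
        convex_hull_barycentric_subset[OF \<open>finite A\<close> sub(2)] by blast
    have "{v. l v \<noteq> 0} \<in> \<S>" "{v. m v \<noteq> 0} \<in> \<S>"
      using triangulating_subset(1)[OF assms(1) assms(3) lm(2)] triangulating_subset(1)[OF assms(1) assms(4) lm(4)] .
    then have "l = m"
      by (rule triangulating_unique[OF assms(1,2) lm(1,3)])
    then show "x \<in> convex hull (W \<inter> W')"
      using lm sub convex_hull_barycentric_subset[OF \<open>finite A\<close>, of "W \<inter> W'" x] by blast
  qed
qed

text \<open>The faces of the hull of an affinely independent set are the hulls of its subsets, so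
  closure under subsets gives closure under faces and makes the intersections faces.\<close>

lemma triangulating_imp_polytope_triangulation:
  fixes P :: "'a::euclidean_space set"
  assumes "triangulating (vertices_of P) \<S>" "finite (vertices_of P)"
    "convex hull vertices_of P = P"
  shows "polytope_triangulation P ((\<lambda>W. convex hull W) ` \<S>)"
proof -
  let ?V = "vertices_of P"
  have sub: "W \<subseteq> ?V" "\<not> affine_dependent W" if "W \<in> \<S>" for W
    using triangulating_subset(2)[OF assms(1) that] triangulating_affine_independent[OF assms(1,2) that]
    by auto
  have faces: "convex hull U face_of convex hull W" if "U \<subseteq> W" "W \<in> \<S>" for U W
    using face_of_convex_hull_affine_independent[OF sub(2)[OF that(2)]] that(1) by blast
  have "finite \<S>"
    using finite_subset[of \<S> "Pow ?V"] assms(2) sub(1) by auto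
  moreover have "\<exists>n. n simplex (convex hull W)" if "W \<in> \<S>" for W
    using sub(2)[OF that] simplex_convex_hull[of W "int (card W) - 1"] by auto
  moreover have "F \<in> (\<lambda>W. convex hull W) ` \<S>" if "W \<in> \<S>" "F face_of convex hull W" for F W
    using that(2) triangulating_subset(1)[OF assms(1) that(1)]
    unfolding face_of_convex_hull_affine_independent[OF sub(2)[OF that(1)]] by blast
  moreover have "convex hull W \<inter> convex hull W' face_of convex hull W" if "W \<in> \<S>" "W' \<in> \<S>" for W W'
    using triangulating_Int[OF assms(1,2) that] faces[of "W \<inter> W'" W] that by simp
  ultimately have "simplicial_complex ((\<lambda>W. convex hull W) ` \<S>)"
    by (auto simp: simplicial_complex_def)
  moreover have "vertices_of (convex hull W) \<subseteq> ?V" if "W \<in> \<S>" for W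
    using sub(1)[OF that] extreme_point_of_convex_hull by (fastforce simp: vertices_of_def)
  moreover have "\<Union> ((\<lambda>W. convex hull W) ` \<S>) = P"
  proof
    show "\<Union> ((\<lambda>W. convex hull W) ` \<S>) \<subseteq> P"
      using hull_mono[OF sub(1), of _ convex] assms(3) by fastforce
    show "P \<subseteq> \<Union> ((\<lambda>W. convex hull W) ` \<S>)"
    proof
      fix x assume "x \<in> P"
      then obtain l where l: "barycentric ?V x l" "{v. l v \<noteq> 0} \<in> \<S>"
        using assms(3) triangulating_exists[OF assms(1)] by auto
      then have "x \<in> convex hull {v. l v \<noteq> 0}"
        using convex_hull_barycentric_subset[OF assms(2) sub(1)[OF l(2)]] by blast
      then show "x \<in> \<Union> ((\<lambda>W. convex hull W) ` \<S>)"
        using l(2) by blast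
    qed
  qed
  ultimately show ?thesis
    by (auto simp: polytope_triangulation_def)
qed

lemma barycentric_full_support:
  assumes "finite A" "W \<subseteq> A" "W \<noteq> {}"
  obtains x l where "barycentric A x l" "{v. l v \<noteq> 0} = W"
proof -
  have "card W \<noteq> 0"
    using assms finite_subset[OF assms(2,1)] by simp
  then show ?thesis
    using that[OF barycentric_uniform[OF assms]] by auto
qed

text \<open>A triangulation cannot be properly contained in another one. The centroid of a set
  \<open>W\<close> of the family lies in some cell of the triangulation; uniqueness of coordinates
  makes \<open>W\<close> part of the vertex set of that cell, so the hull of \<open>W\<close> is one
  of its faces.\<close>

lemma polytope_triangulation_eq:
  fixes P :: "'a::euclidean_space set"
  assumes "triangulating (vertices_of P) \<S>" "finite (vertices_of P)"
    "convex hull vertices_of P = P" "P \<noteq> {}"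
    and tri: "polytope_triangulation P \<T>"
    and cells: "\<And>S. S \<in> \<T> \<Longrightarrow> vertices_of S \<in> \<S>"
  shows "\<T> = (\<lambda>W. convex hull W) ` \<S>"
proof -
  let ?V = "vertices_of P"
  have vertices: "S = convex hull vertices_of S" "\<not> affine_dependent (vertices_of S)" if S: "S \<in> \<T>" for S
  proof -
    obtain C where C: "\<not> affine_dependent C" "S = convex hull C"
      using tri S by (auto simp: polytope_triangulation_def simplicial_complex_def simplex_def)
    then have "vertices_of S = C"
      by (simp add: vertices_of_def extreme_point_of_convex_hull_affine_independent)
    then show "S = convex hull vertices_of S" "\<not> affine_dependent (vertices_of S)"
      using C by auto
  qed
  have face: "F \<in> \<T>" if "S \<in> \<T>" "F face_of S" for S F
    using that tri unfolding polytope_triangulation_def simplicial_complex_def by blast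
  have cover: "\<Union>\<T> = P"
    using tri by (simp add: polytope_triangulation_def)
  have "convex hull W \<in> \<T>" if W: "W \<in> \<S>" for W
  proof (cases "W = {}")
    case True
    obtain S where "S \<in> \<T>"
      using cover assms(4) by blast
    then show ?thesis
      using face[of S "{}"] True by simp
  next
    case False
    have WV: "W \<subseteq> ?V"
      using triangulating_subset(2)[OF assms(1) W] .
    obtain x l where l: "barycentric ?V x l" "{v. l v \<noteq> 0} = W"
      using barycentric_full_support[OF assms(2) WV False] .
    then have "x \<in> P"
      using convex_hull_barycentric[OF assms(2)] assms(3) by blast
    then obtain S where S: "S \<in> \<T>" "x \<in> S"
      using cover by blast
    have SV: "vertices_of S \<subseteq> ?V"
      using triangulating_subset(2)[OF assms(1) cells[OF S(1)]] .
    have "x \<in> convex hull vertices_of S"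
      using S vertices(1) by simp
    then obtain m where m: "barycentric ?V x m" "{v. m v \<noteq> 0} \<subseteq> vertices_of S"
      using convex_hull_barycentric_subset[OF assms(2) SV] by blast
    have "l = m"
      using triangulating_unique[OF assms(1,2) l(1) m(1)] l(2) W
        triangulating_subset(1)[OF assms(1) cells[OF S(1)] m(2)] by simp
    then have "W \<subseteq> vertices_of S"
      using l(2) m(2) by simp
    then have "convex hull W face_of convex hull vertices_of S"
      using face_of_convex_hull_affine_independent[OF vertices(2)[OF S(1)]] by blast
    then have "convex hull W face_of S"
      using vertices(1)[OF S(1)] by simp
    then show ?thesis
      using face S by blast
  qed
  moreover have "S \<in> (\<lambda>W. convex hull W) ` \<S>" if "S \<in> \<T>" for S
    using vertices(1)[OF that] cells[OF that] by blast
  ultimately show ?thesis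
    by blast
qed

section \<open>Regularity\<close>

text \<open>This turns questions about the lower envelope into minimising the linear functional
  given by \<open>w\<close> over the coordinates of a fixed point.\<close>

lemma lifted_polytope_eq:
  assumes "finite A"
  shows "lifted_polytope A w = {(x, \<Sum>v\<in>A. l v * w v) |x l. barycentric A x l}"
proof -
  let ?f = "\<lambda>a. (a, w a)"
  have inj: "inj_on ?f A" by (auto simp: inj_on_def)
  have fst_snd: "(\<Sum>v\<in>A. l v *\<^sub>R ?f v) = ((\<Sum>v\<in>A. l v *\<^sub>R v), (\<Sum>v\<in>A. l v * w v))" for l :: "'a \<Rightarrow> real"
    by (auto simp: prod_eq_iff fst_sum snd_sum)
  show ?thesis
  proof (intro subset_antisym subsetI)
    fix y assume "y \<in> lifted_polytope A w"
    then obtain u where u: "\<forall>v\<in>?f ` A. 0 \<le> u v" "sum u (?f ` A) = 1" "(\<Sum>v\<in>?f ` A. u v *\<^sub>R v) = y"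
      using assms by (auto simp: lifted_polytope_def convex_hull_finite)
    define l where "l = (\<lambda>v. if v \<in> A then u (?f v) else 0)"
    have "sum l A = 1"
      using u(2) unfolding sum.reindex[OF inj] by (simp add: l_def)
    moreover have "(\<Sum>v\<in>A. l v *\<^sub>R ?f v) = y"
      using u(3) unfolding sum.reindex[OF inj] by (auto simp: l_def intro: sum.cong)
    ultimately have "barycentric A (\<Sum>v\<in>A. l v *\<^sub>R v) l" "y = ((\<Sum>v\<in>A. l v *\<^sub>R v), (\<Sum>v\<in>A. l v * w v))"
      using u(1) unfolding fst_snd by (auto simp: barycentric_def l_def)
    then show "y \<in> {(x, \<Sum>v\<in>A. l v * w v) |x l. barycentric A x l}"
      by blast
  next
    fix y assume "y \<in> {(x, \<Sum>v\<in>A. l v * w v) |x l. barycentric A x l}"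
    then obtain x l where l: "barycentric A x l" "y = (x, \<Sum>v\<in>A. l v * w v)"
      by blast
    then have "y = (\<Sum>v\<in>A. l v *\<^sub>R ?f v)"
      unfolding fst_snd by (simp add: barycentric_def)
    also have "\<dots> \<in> convex hull (?f ` A)"
      using l(1) assms by (intro convex_sum) (auto simp: barycentric_def hull_inc)
    finally show "y \<in> lifted_polytope A w"
      by (simp add: lifted_polytope_def)
  qed
qed

lemma lifted_polytope_subset:
  fixes A :: "'a::euclidean_space set"
  assumes "finite A" "W \<subseteq> A"
  shows "(x, s) \<in> convex hull ((\<lambda>a. (a, w a)) ` W) \<longleftrightarrow>
    (\<exists>l. barycentric A x l \<and> {v. l v \<noteq> 0} \<subseteq> W \<and> s = (\<Sum>v\<in>A. l v * w v))"
proof -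
  have bary: "barycentric A x l \<and> {v. l v \<noteq> 0} \<subseteq> W \<longleftrightarrow> barycentric W x l" for l
    using barycentric_superset[OF assms, of l x] by (auto simp: barycentric_def)
  have "(\<Sum>v\<in>A. l v * w v) = (\<Sum>v\<in>W. l v * w v)" if "{v. l v \<noteq> 0} \<subseteq> W" for l
    using that assms by (intro sum.mono_neutral_right) auto
  moreover have "(x, s) \<in> convex hull ((\<lambda>a. (a, w a)) ` W) \<longleftrightarrow> (\<exists>l. barycentric W x l \<and> s = (\<Sum>v\<in>W. l v * w v))"
    using lifted_polytope_eq[OF finite_subset[OF assms(2,1)], of w] by (auto simp: lifted_polytope_def)
  ultimately show ?thesis
    unfolding bary[symmetric] by auto
qed

text \<open>A criterion for a weight to induce a given family. A face in the envelope is the hull of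
  the lift of some \<open>W\<close>; the centroid of \<open>W\<close> has minimal height with full
  support, so strictness forces \<open>W\<close> into the family. Conversely, the lift of a cell
  lies in the envelope, and it is a face because coordinates of minimal height are unique.\<close>

lemma projected_lower_envelope_eq:
  fixes A :: "'a::euclidean_space set"
  assumes "triangulating A \<S>" "finite A"
    and less: "\<And>x l m. barycentric A x l \<Longrightarrow> barycentric A x m \<Longrightarrow> {v. l v \<noteq> 0} \<in> \<S> \<Longrightarrow> l \<noteq> m \<Longrightarrow>
      (\<Sum>v\<in>A. l v * w v) < (\<Sum>v\<in>A. m v * w v)"
  shows "projected_lower_envelope A w = (\<lambda>W. convex hull W) ` \<S>"
proof -
  let ?Q = "lifted_polytope A w" and ?f = "\<lambda>a. (a, w a)"
  note Q = lifted_polytope_eq[OF assms(2), of w]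
  have img: "fst ` (convex hull (?f ` W)) = convex hull W" for W
    by (simp only: convex_hull_linear_image[OF linear_fst] image_image fst_conv image_ident)
  note hull = lifted_polytope_subset[OF assms(2)]
  show ?thesis
  proof (intro subset_antisym subsetI)
    fix C assume "C \<in> projected_lower_envelope A w"
    then obtain F where F: "C = fst ` F" "F face_of ?Q" "F \<subseteq> lower_envelope ?Q"
      by (auto simp: projected_lower_envelope_def)
    have "compact (?f ` A)"
      using assms(2) by (simp add: finite_imp_compact)
    then obtain W where W: "W \<subseteq> A" "F = convex hull (?f ` W)"
      using face_of_convex_hull_subset[of "?f ` A" F] F(2)
      by (auto simp: lifted_polytope_def subset_image_iff)
    have "W \<in> \<S>"
    proof (cases "W = {}")
      case True
      then show ?thesis using assms(1) by (simp add: triangulating_def)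
    next
      case False
      obtain x l where l: "barycentric A x l" "{v. l v \<noteq> 0} = W"
        using barycentric_full_support[OF assms(2) W(1) False] .
      have "(x, \<Sum>v\<in>A. l v * w v) \<in> F"
        unfolding W(2) hull[OF W(1)] using l by blast
      then have low: "(\<Sum>v\<in>A. l v * w v) \<le> s" if "(x, s) \<in> ?Q" for s
        using F(3) that by (auto simp: lower_envelope_def)
      have "x \<in> convex hull A"
        using l(1) convex_hull_barycentric[OF assms(2)] by blast
      then obtain m where m: "barycentric A x m" "{v. m v \<noteq> 0} \<in> \<S>"
        using triangulating_exists[OF assms(1)] by blast
      have "m = l"
      proof (rule ccontr)
        assume "m \<noteq> l"
        then have "(\<Sum>v\<in>A. m v * w v) < (\<Sum>v\<in>A. l v * w v)"
          using less[OF m(1) l(1) m(2)] by blast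
        moreover have "(x, \<Sum>v\<in>A. m v * w v) \<in> ?Q"
          unfolding Q using m(1) by blast
        ultimately show False using low by fastforce
      qed
      then show ?thesis
        using m(2) l(2) by simp
    qed
    then show "C \<in> (\<lambda>W. convex hull W) ` \<S>"
      using F(1) W(2) img by auto
  next
    fix C assume "C \<in> (\<lambda>W. convex hull W) ` \<S>"
    then obtain W where W: "W \<in> \<S>" "C = convex hull W"
      by blast
    have WA: "W \<subseteq> A"
      using triangulating_subset(2)[OF assms(1) W(1)] .
    let ?F = "convex hull (?f ` W)"
    have low: "?F \<subseteq> lower_envelope ?Q"
    proof
      fix y assume y: "y \<in> ?F"
      obtain x s where xs: "y = (x, s)" by fastforce
      obtain l where l: "barycentric A x l" "{v. l v \<noteq> 0} \<subseteq> W" "s = (\<Sum>v\<in>A. l v * w v)"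
        using y xs hull[OF WA] by blast
      have lS: "{v. l v \<noteq> 0} \<in> \<S>"
        using triangulating_subset(1)[OF assms(1) W(1) l(2)] .
      have "s \<le> t" if "(x, t) \<in> ?Q" for t
      proof -
        obtain m where "barycentric A x m" "t = (\<Sum>v\<in>A. m v * w v)"
          using \<open>(x, t) \<in> ?Q\<close> unfolding Q by blast
        then show ?thesis
          using less[OF l(1) _ lS, of m] l(3) by (cases "l = m") auto
      qed
      moreover have "(x, s) \<in> ?Q"
        unfolding Q using l by blast
      ultimately show "y \<in> lower_envelope ?Q"
        using xs by (auto simp: lower_envelope_def)
    qed
    have "?F face_of ?Q"
      unfolding face_of_def
    proof (intro conjI ballI impI)
      show "?F \<subseteq> ?Q"
        unfolding lifted_polytope_def using WA by (intro hull_mono image_mono)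
      show "convex ?F" by simp
      fix y z u
      assume yz: "y \<in> ?Q" "z \<in> ?Q" and u: "u \<in> ?F" and seg: "u \<in> open_segment y z"
      obtain t where t: "0 < t" "t < 1" "u = (1 - t) *\<^sub>R y + t *\<^sub>R z"
        using seg by (auto simp: in_segment)
      obtain m where m: "barycentric A (fst y) m" "snd y = (\<Sum>v\<in>A. m v * w v)"
        using yz(1) unfolding Q by auto
      obtain n where n: "barycentric A (fst z) n" "snd z = (\<Sum>v\<in>A. n v * w v)"
        using yz(2) unfolding Q by auto
      define k where "k = (\<lambda>v. (1 - t) * m v + t * n v)"
      have k: "barycentric A (fst u) k"
        using barycentric_convex_comb[OF m(1) n(1), of t] t by (simp add: k_def)
      have ksum: "snd u = (\<Sum>v\<in>A. k v * w v)"
      proof -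
        have "(\<Sum>v\<in>A. k v * w v) = (1 - t) * (\<Sum>v\<in>A. m v * w v) + t * (\<Sum>v\<in>A. n v * w v)"
          by (simp only: k_def distrib_right mult.assoc sum.distrib sum_distrib_left)
        then show ?thesis
          using t(3) m(2) n(2) by simp
      qed
      obtain l where l: "barycentric A (fst u) l" "{v. l v \<noteq> 0} \<subseteq> W" "snd u = (\<Sum>v\<in>A. l v * w v)"
        using u hull[OF WA, of "fst u" "snd u"] by auto
      \<comment> \<open>Both have the same height above the same point, so strict minimality of
        \<open>l\<close> leaves no other possibility. As \<open>k\<close> averages the nonnegative
        \<open>m\<close> and \<open>n\<close> with positive factors, these also vanish off
        \<open>W\<close>.\<close>
      have "l = k"
        using less[OF l(1) k triangulating_subset(1)[OF assms(1) W(1) l(2)]] l(3) ksum by fastforce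
      have nonneg: "0 \<le> m v" "0 \<le> n v" for v
        using m(1) n(1) by (auto simp: barycentric_def)
      have "m v = 0 \<and> n v = 0" if "v \<notin> W" for v
      proof -
        have "k v = 0" using that l(2) \<open>l = k\<close> by blast
        then show ?thesis
          using nonneg[of v] t unfolding k_def
          by (metis add_nonneg_eq_0_iff diff_gt_0_iff_gt less_imp_le mult_eq_0_iff mult_nonneg_nonneg order_less_irrefl)
      qed
      then have "{v. m v \<noteq> 0} \<subseteq> W" "{v. n v \<noteq> 0} \<subseteq> W" by blast+
      then have "(fst y, snd y) \<in> ?F" "(fst z, snd z) \<in> ?F"
        unfolding hull[OF WA] using m n by blast+
      then show "y \<in> ?F" "z \<in> ?F" by simp_all
    qed
    then show "C \<in> projected_lower_envelope A w"
      unfolding projected_lower_envelope_def using low W(2) img by blast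
  qed
qed

text \<open>A converse: a cell of an induced subdivision yields strict inequalities for the weight.
  If \<open>m\<close> were not higher than \<open>l\<close>, its lift would be the lift of
  \<open>l\<close>, a point of the face \<open>F\<close> above \<open>W\<close>. Then
  \<open>F\<close> would contain the lift of a vertex \<open>v\<close> outside \<open>W\<close>, and
  \<open>v\<close> would lie in the hull of \<open>W\<close>.\<close>

lemma projected_lower_envelope_less:
  fixes P :: "'a::euclidean_space set"
  assumes fin: "finite (vertices_of P)" and hull: "convex hull vertices_of P = P"
    and W: "W \<subseteq> vertices_of P" "convex hull W \<in> projected_lower_envelope (vertices_of P) w"
    and l: "barycentric (vertices_of P) x l" "{v. l v \<noteq> 0} \<subseteq> W"
    and m: "barycentric (vertices_of P) x m" "\<not> {v. m v \<noteq> 0} \<subseteq> W"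
  shows "(\<Sum>v\<in>vertices_of P. l v * w v) < (\<Sum>v\<in>vertices_of P. m v * w v)"
proof -
  let ?V = "vertices_of P"
  let ?Q = "lifted_polytope ?V w"
  let ?h = "\<lambda>l. \<Sum>v\<in>?V. l v * w v"
  note Q = lifted_polytope_eq[OF fin, of w]
  obtain F where F: "F face_of ?Q" "F \<subseteq> lower_envelope ?Q" "convex hull W = fst ` F"
    using W(2) by (auto simp: projected_lower_envelope_def)
  have FQ: "F \<subseteq> ?Q" and "convex F"
    using F(1) face_of_imp_subset face_of_imp_convex by blast+
  have lift: "(a, w a) \<in> F" if a: "a \<in> W" for a
  proof -
    have aV: "a \<in> ?V" using a W(1) by blast
    have "a \<in> fst ` F"
      using a F(3) hull_inc by metis
    then obtain s where s: "(a, s) \<in> F" by auto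
    then have "(a, s) \<in> ?Q" using FQ by blast
    then obtain k where k: "barycentric ?V a k" "s = ?h k"
      unfolding Q by blast
    \<comment> \<open>A vertex has only its trivial coordinates, so the lifted polytope has the
      single height \<open>w a\<close> above \<open>a\<close>.\<close>
    have "s = w a"
      unfolding k(2) barycentric_vertex_unique[OF fin hull aV k(1)] using aV fin
      by (simp add: if_distrib[of "\<lambda>c. c * _"] cong: if_cong)
    then show ?thesis using s by simp
  qed
  have "(x, ?h l) \<in> F"
  proof -
    have "(x, ?h l) \<in> convex hull ((\<lambda>a. (a, w a)) ` W)"
      unfolding lifted_polytope_subset[OF fin W(1)] using l by blast
    also have "\<dots> \<subseteq> F"
      using lift \<open>convex F\<close> by (intro hull_minimal) auto
    finally show ?thesis .
  qed
  show ?thesis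
  proof (rule ccontr)
    assume not_less: "\<not> ?h l < ?h m"
    have mQ: "(x, ?h m) \<in> ?Q" unfolding Q using m by blast
    then have "?h m = ?h l"
      using not_less \<open>(x, ?h l) \<in> F\<close> F(2) by (fastforce simp: lower_envelope_def)
    then have mF: "(x, ?h m) \<in> F" using \<open>(x, ?h l) \<in> F\<close> by simp
    obtain v where v: "m v \<noteq> 0" "v \<notin> W" using m(2) by blast
    have v01: "0 < m v" "v \<in> ?V"
      using v m(1) by (auto simp: barycentric_def less_le)
    \<comment> \<open>Splitting \<open>v\<close> off from \<open>m\<close> displays the lifted point
      either as the lift of \<open>v\<close> or as an inner point of a segment ending there; a face
      contains both ends of such a segment.\<close>
    have "(v, w v) \<in> F"
    proof -
      let ?A = "?V - {v}"
      have A: "finite ?A" "v \<notin> ?A" "insert v ?A = ?V"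
        using fin v01 by auto
      have hm: "?h m = m v * w v + (\<Sum>u\<in>?A. m u * w u)"
        using sum.remove[OF fin v01(2)] by blast
      have "barycentric (insert v ?A) x m"
        using m A(3) by simp
      with A(1,2) show ?thesis
      proof (cases rule: barycentric_insertE)
        case 1
        then have "?h m = w v" using hm by simp
        then show ?thesis using mF 1(2) by simp
      next
        case (2 k y)
        have "barycentric ?V y k"
          using 2(3) barycentric_mono[OF fin, of ?A] by blast
        then have yQ: "(y, ?h k) \<in> ?Q" unfolding Q by blast
        have vQ: "(v, w v) \<in> ?Q"
          unfolding lifted_polytope_def using v01(2) by (intro hull_inc) auto
        have "k v = 0"
          using 2(6) by blast
        then have "(\<Sum>u\<in>?A. m u * w u) = (1 - m v) * ?h k"
          using 2(5) sum.remove[OF fin v01(2), of "\<lambda>u. k u * w u"]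
          by (simp add: sum_distrib_left mult.assoc)
        then have eq: "(x, ?h m) = (1 - m v) *\<^sub>R (y, ?h k) + m v *\<^sub>R (v, w v)"
          using hm 2(4) by simp
        show ?thesis
        proof (cases "(y, ?h k) = (v, w v)")
          case True
          then have "(x, ?h m) = (v, w v)"
            using eq by (simp add: algebra_simps)
          then show ?thesis using mF by simp
        next
          case False
          then have "(x, ?h m) \<in> open_segment (y, ?h k) (v, w v)"
            using eq v01(1) 2(2) by (auto simp: in_segment intro!: exI[of _ "m v"])
          then show ?thesis
            using face_ofD[OF F(1)] yQ vQ mF by blast
        qed
      qed
    qed
    then have "v \<in> convex hull W" using F(3) by force
    moreover have "W \<subseteq> P" "convex P"
      using W(1) hull hull_subset[of ?V convex] convex_convex_hull[of ?V] by auto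
    ultimately show False
      using vertices_not_in_hull[of P v W] v01(2) v(2) by blast
  qed
qed

text \<open>Equal sums mean that the two triples have the same centroid; the inequality is the
  comparison of its heights, multiplied by 3.\<close>

lemma projected_lower_envelope_less_triple:
  fixes P :: "'a::euclidean_space set"
  assumes "finite (vertices_of P)" "convex hull vertices_of P = P"
    and V: "{a, b, c, a', b', c'} \<subseteq> vertices_of P" and dist: "distinct [a, b, c, a', b', c']"
    and cell: "convex hull {a, b, c} \<in> projected_lower_envelope (vertices_of P) w"
    and eq: "a + b + c = a' + b' + c'"
  shows "w a + w b + w c < w a' + w b' + w c'"
proof -
  have bary: "barycentric (vertices_of P) ((u + v + z) /\<^sub>R 3) (\<lambda>x. if x \<in> {u, v, z} then 1 / 3 else 0)"
    if "distinct [u, v, z]" "{u, v, z} \<subseteq> vertices_of P" for u v z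
  proof -
    have "card {u, v, z} = 3" "\<Sum>{u, v, z} = u + v + z"
      using that(1) by (simp_all add: add.assoc)
    then show ?thesis
      using barycentric_uniform[OF assms(1) that(2)] by (simp cong: if_cong)
  qed
  have sum: "(\<Sum>x\<in>vertices_of P. (if x \<in> {u, v, z} then 1 / 3 else 0) * w x) = (w u + w v + w z) / 3"
    if "distinct [u, v, z]" "{u, v, z} \<subseteq> vertices_of P" for u v z
  proof -
    have "(\<Sum>x\<in>vertices_of P. (if x \<in> {u, v, z} then 1 / 3 else 0) * w x)
        = (\<Sum>x\<in>{u, v, z}. (if x \<in> {u, v, z} then 1 / 3 else 0) * w x)"
      using that(2) assms(1) by (intro sum.mono_neutral_right) auto
    also have "\<dots> = (w u + w v + w z) / 3"
      using that(1) by (simp add: add_divide_distrib)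
    finally show ?thesis .
  qed
  have d: "distinct [a, b, c]" "distinct [a', b', c']" and s: "{a, b, c} \<subseteq> vertices_of P" "{a', b', c'} \<subseteq> vertices_of P"
    using dist V by auto
  have supp: "{x. (if x \<in> X then 1 / 3 else 0) \<noteq> (0::real)} = X" for X :: "'a set"
    by auto
  have "\<not> {a', b', c'} \<subseteq> {a, b, c}" using dist by auto
  then have "(\<Sum>x\<in>vertices_of P. (if x \<in> {a, b, c} then 1 / 3 else 0) * w x)
      < (\<Sum>x\<in>vertices_of P. (if x \<in> {a', b', c'} then 1 / 3 else 0) * w x)"
    using bary[OF d(1) s(1)] bary[OF d(2) s(2)] eq
    by (intro projected_lower_envelope_less[OF assms(1,2) s(1) cell, where x = "(a + b + c) /\<^sub>R 3"])
      (simp_all only: supp subset_refl not_False_eq_True)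
  then show ?thesis
    unfolding sum[OF d(1) s(1)] sum[OF d(2) s(2)] by simp
qed

section \<open>Placing triangulations\<close>

text \<open>The weights that \<open>p\<close> can carry in \<open>x\<close> against a point of
  \<open>A\<close>. Being a projection of a closed part of a compact product, this set attains its
  minimum, as placing requires, and its maximum, as needed for the eleven points.\<close>

lemma compact_segment_parameters:
  fixes A :: "'a::real_normed_vector set"
  assumes "compact A"
  shows "compact {t \<in> {0..1}. \<exists>z\<in>A. x = (1 - t) *\<^sub>R z + t *\<^sub>R p}"
proof -
  let ?g = "\<lambda>u::real \<times> 'a. (1 - fst u) *\<^sub>R snd u + fst u *\<^sub>R p"
  let ?D = "({0..1} \<times> A) \<inter> ?g -` {x}"
  have cont: "continuous_on ({0..1} \<times> A) ?g"
    by (intro continuous_intros)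
  have comp: "compact ({0..1::real} \<times> A)"
    using assms by (intro compact_Times) auto
  have "closed ?D"
    by (rule continuous_closed_preimage[OF cont compact_imp_closed[OF comp]]) simp
  then have "compact (({0..1} \<times> A) \<inter> ?D)"
    by (rule compact_Int_closed[OF comp])
  then have "compact ?D"
    by (simp only: Int_left_absorb)
  then have "compact (fst ` ?D)"
    by (intro compact_continuous_image continuous_intros)
  also have "fst ` ?D = {t \<in> {0..1}. \<exists>z\<in>A. x = (1 - t) *\<^sub>R z + t *\<^sub>R p}"
    by (force simp: image_iff)
  finally show ?thesis .
qed

text \<open>The new cells are the cones from \<open>p\<close> over the cells all of whose points are visible from \<open>p\<close>: their
  coordinates give \<open>p\<close> the least possible weight.\<close>

lemma triangulating_insert:
  fixes A :: "'a::euclidean_space set"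
  assumes tri: "triangulating A \<S>" and fin: "finite A" and p: "p \<notin> convex hull A" and ne: "A \<noteq> {}"
  obtains \<S>' where "\<S> \<subseteq> \<S>'" "triangulating (insert p A) \<S>'"
proof -
  \<comment> \<open>The segment from \<open>y\<close> to \<open>p\<close> must leave the old hull at
    \<open>y\<close> itself, hence the condition \<open>0 < r\<close>.\<close>
  define visible where "visible y \<longleftrightarrow> (\<forall>r. 0 < r \<and> r \<le> 1 \<longrightarrow> (1 - r) *\<^sub>R y + r *\<^sub>R p \<notin> convex hull A)" for y
  define \<S>' where "\<S>' = \<S> \<union> {insert p W |W. W \<in> \<S> \<and> (\<forall>y\<in>convex hull W. visible y)}"
  have pA: "p \<notin> A" using p hull_inc[of p A convex] by blast
  have sub: "W - {p} \<in> \<S>" if W: "W \<in> \<S>'" for W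
  proof -
    obtain U where U: "U \<in> \<S>" "W \<subseteq> insert p U"
      using W unfolding \<S>'_def by blast
    then show ?thesis
      using triangulating_subset(1)[OF tri U(1)] U(2) by blast
  qed
  have vis: "visible y" if W: "W \<in> \<S>'" "p \<in> W" "y \<in> convex hull (W - {p})" for W y
  proof -
    have "W \<notin> \<S>" using triangulating_subset(2)[OF tri, of W] W(2) pA by blast
    then obtain U where U: "W = insert p U" "U \<in> \<S>" "\<forall>y\<in>convex hull U. visible y"
      using W(1) unfolding \<S>'_def by blast
    have "W - {p} \<subseteq> U" using U(1) by blast
    then show ?thesis using U(3) W(3) hull_mono[of "W - {p}" U convex] by blast
  qed
  \<comment> \<open>Cells of the new family minimise the weight of \<open>p\<close>. If
    \<open>m\<close> used less of \<open>p\<close> than \<open>l\<close>, then the part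
    \<open>z\<close> of \<open>x\<close> in the old hull would lie on the segment from the part
    \<open>y\<close> of \<open>l\<close> towards \<open>p\<close>, at the positive parameter
    \<open>r\<close> below, against visibility of \<open>y\<close>.\<close>
  have le: "l p \<le> m p" if l: "barycentric (insert p A) x l" and m: "barycentric (insert p A) x m"
    and lS: "{v. l v \<noteq> 0} \<in> \<S>'" for x l m
  proof (rule ccontr)
    assume "\<not> l p \<le> m p"
    then have less: "m p < l p" by simp
    obtain n z where n: "0 \<le> m p" "m p < 1" "barycentric A z n" "x = (1 - m p) *\<^sub>R z + m p *\<^sub>R p"
      using fin pA m
    proof (cases rule: barycentric_insertE)
      case 1
      have "l p \<le> 1" using l pA fin sum_nonneg[of A l] by (auto simp: barycentric_def)
      then show ?thesis using less 1 by simp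
    qed auto
    have z: "z \<in> convex hull A" using n(3) convex_hull_barycentric[OF fin] by blast
    show False
      using fin pA l
    proof (cases rule: barycentric_insertE)
      case 1
      have "(1 - m p) *\<^sub>R (p - z) = p - ((1 - m p) *\<^sub>R z + m p *\<^sub>R p)"
        by (simp add: algebra_simps)
      also have "\<dots> = 0" using n(4) 1 by simp
      finally have "p = z" using n(2) by simp
      then show ?thesis using z p by simp
    next
      case (2 k y)
      have "y \<in> convex hull {v. k v \<noteq> 0}"
        using 2(3) convex_hull_barycentric_subset[OF fin, of "{v. k v \<noteq> 0}" y] by (auto simp: barycentric_def)
      then have "visible y"
        using vis[OF lS] 2(6) less n(1) by auto
      define r where "r = (l p - m p) / (1 - m p)"
      have r: "0 < r" "r \<le> 1" "(1 - m p) * r = l p - m p" "(1 - m p) * (1 - r) = 1 - l p"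
        using less n(2) 2(2) by (auto simp: r_def field_simps)
      have "(1 - m p) *\<^sub>R z = (1 - l p) *\<^sub>R y + (l p - m p) *\<^sub>R p"
        using 2(4) n(4) by (simp add: algebra_simps)
      also have "\<dots> = (1 - m p) *\<^sub>R ((1 - r) *\<^sub>R y + r *\<^sub>R p)"
        unfolding r(3,4)[symmetric] by (simp add: scaleR_add_right)
      finally have "z = (1 - r) *\<^sub>R y + r *\<^sub>R p"
        using n(2) by simp
      then show ?thesis
        using \<open>visible y\<close> z r(1,2) unfolding visible_def by blast
    qed
  qed
  have "triangulating (insert p A) \<S>'"
  proof (rule triangulatingI)
    show "finite (insert p A)" using fin by simp
    show "\<S>' \<subseteq> Pow (insert p A)" "{} \<in> \<S>'"
      using tri by (auto simp: triangulating_def \<S>'_def)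
    show "U \<in> \<S>'" if "W \<in> \<S>'" "U \<subseteq> W" for W U
    proof (cases "p \<in> U")
      case False
      then have "U \<subseteq> W - {p}" using that by blast
      then have "U \<in> \<S>" by (rule triangulating_subset(1)[OF tri sub[OF that(1)]])
      then show ?thesis by (simp add: \<S>'_def)
    next
      case True
      then have "U - {p} \<subseteq> W - {p}" "p \<in> W" using that by auto
      then have "U - {p} \<in> \<S>" "\<forall>y\<in>convex hull (U - {p}). visible y"
        using triangulating_subset(1)[OF tri sub[OF that(1)], of "U - {p}"] vis[OF that(1)]
          hull_mono[of "U - {p}" "W - {p}" convex] by auto
      moreover have "U = insert p (U - {p})" using True by auto
      ultimately show ?thesis unfolding \<S>'_def by blast
    qed
  next
    fix x l m
    assume l: "barycentric (insert p A) x l" and m: "barycentric (insert p A) x m"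
      and lS: "{v. l v \<noteq> 0} \<in> \<S>'" and mS: "{v. m v \<noteq> 0} \<in> \<S>'"
    \<comment> \<open>Once the weights of \<open>p\<close> agree, the remaining parts are
      coordinates of one and the same point of the old hull, and uniqueness for the old family
      applies.\<close>
    have eq: "l p = m p" using le[OF l m lS] le[OF m l mS] by simp
    show "l = m"
      using fin pA l
    proof (cases rule: barycentric_insertE)
      case l: 1
      show ?thesis
        using fin pA m
      proof (cases rule: barycentric_insertE)
        case 1
        show ?thesis
        proof
          show "l v = m v" for v
            using 1 l by (cases "v = p") auto
        qed
      next
        case 2
        show ?thesis using l(1) 2(2) eq by linarith
      qed
    next
      case l: (2 k y)
      show ?thesis
        using fin pA m
      proof (cases rule: barycentric_insertE)
        case 1
        show ?thesis using l(2) 1(1) eq by linarith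
      next
        case m: (2 n z)
        have "(1 - l p) *\<^sub>R y = (1 - l p) *\<^sub>R z"
          using l(4) m(4)[folded eq] by (metis add_right_cancel)
        then have "y = z" using l(2) by simp
        have kn: "k = n"
          using triangulating_unique[OF tri fin l(3)] m(3) \<open>y = z\<close> sub[OF lS] sub[OF mS] l(6) m(6) by simp
        have "l v = m v" for v
        proof (cases "v = p")
          case False
          show ?thesis
            unfolding l(5)[OF False] m(5)[OF False] eq kn ..
        qed (use eq in simp)
        then show ?thesis by blast
      qed
    qed
  next
    fix x l0 assume l0: "barycentric (insert p A) x l0"
    obtain s0 y0 where sy0: "y0 \<in> convex hull A" "x = (1 - s0) *\<^sub>R y0 + s0 *\<^sub>R p" "0 \<le> s0" "s0 \<le> 1"
      using fin pA l0
    proof (cases rule: barycentric_insertE)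
      case 1
      obtain a where "a \<in> A" using ne by blast
      then show ?thesis using 1 that[of a 1] hull_inc[of a A convex] by simp
    next
      case (2 m y)
      have "y \<in> convex hull A"
        using 2(3) convex_hull_barycentric[OF fin] by blast
      then show ?thesis
        using 2(1,2,4) by (intro that[of y "l0 p"]) simp_all
    qed
    define T where "T = {t \<in> {0..1}. \<exists>z\<in>convex hull A. x = (1 - t) *\<^sub>R z + t *\<^sub>R p}"
    have "compact T"
      unfolding T_def by (rule compact_segment_parameters[OF finite_imp_compact_convex_hull[OF fin]])
    moreover have "T \<noteq> {}"
      using sy0 by (auto simp: T_def)
    \<comment> \<open>With \<open>p\<close> given its least possible weight \<open>s\<close>, the
      remaining part \<open>y\<close> should be visible from \<open>p\<close>, and with it the whole
      cell \<open>W\<close> that supports \<open>y\<close>.\<close>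
    ultimately obtain s where sT: "s \<in> T" "\<forall>t\<in>T. s \<le> t"
      using compact_attains_inf by blast
    then obtain y where y: "y \<in> convex hull A" and x: "x = (1 - s) *\<^sub>R y + s *\<^sub>R p" and s: "0 \<le> s" "s \<le> 1"
      unfolding T_def by fastforce
    have min: "s \<le> t" if "z \<in> convex hull A" "x = (1 - t) *\<^sub>R z + t *\<^sub>R p" "0 \<le> t" "t \<le> 1" for t z
    proof -
      have "t \<in> T" unfolding T_def using that by fastforce
      then show ?thesis using sT(2) by blast
    qed
    obtain l where l: "barycentric A y l" "{v. l v \<noteq> 0} \<in> \<S>"
      using triangulating_exists[OF tri y] by blast
    define W where "W = {v. l v \<noteq> 0}"
    let ?m = "\<lambda>v. if v = p then s else (1 - s) * l v"
    have m: "barycentric (insert p A) x ?m"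
      using barycentric_insert[OF fin pA l(1) s] x by simp
    have lp: "l p = 0" using l(1) pA by (auto simp: barycentric_def)
    have "{v. ?m v \<noteq> 0} \<in> \<S>'"
    proof -
      consider "s = 0" | "s = 1" | "0 < s" "s < 1" using s by linarith
      then show ?thesis
      proof cases
        case 1
        then have "{v. ?m v \<noteq> 0} = W" using lp by (auto simp: W_def)
        then show ?thesis using l(2) by (simp add: \<S>'_def W_def)
      next
        case 2
        then have "{v. ?m v \<noteq> 0} = insert p {}" by auto
        moreover have "{} \<in> \<S>" using tri by (simp add: triangulating_def)
        ultimately show ?thesis by (auto simp: \<S>'_def)
      next
        case 3
        then have "{v. ?m v \<noteq> 0} = insert p W" by (auto simp: W_def)
        \<comment> \<open>Suppose \<open>z\<close> in the hull of \<open>W\<close> is not visible,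
          with \<open>q\<close> in the old hull on the way from \<open>z\<close> to
          \<open>p\<close>. Since \<open>y\<close> has positive weight on all of \<open>W\<close>,
          it contains a small share \<open>d\<close> of \<open>z\<close>. Exchanging this share,
          together with some of \<open>p\<close>, for \<open>q\<close> lowers the weight of
          \<open>p\<close> below \<open>s\<close>.\<close>
        moreover have "visible z" if z: "z \<in> convex hull W" for z
        proof (rule ccontr)
          assume "\<not> visible z"
          then obtain r where r: "0 < r" "r \<le> 1" "(1 - r) *\<^sub>R z + r *\<^sub>R p \<in> convex hull A"
            by (auto simp: visible_def)
          define q where "q = (1 - r) *\<^sub>R z + r *\<^sub>R p"
          have "r \<noteq> 1" using r(3) p by auto
          then have r1: "r < 1" using r by simp
          have WA: "W \<subseteq> A" using triangulating_subset(2)[OF tri l(2)] by (simp add: W_def)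
          obtain k where k: "barycentric A z k" "{v. k v \<noteq> 0} \<subseteq> W"
            using z convex_hull_barycentric_subset[OF fin WA] by blast
          \<comment> \<open>The share must be small enough for the coordinates of \<open>y\<close>
            to stay nonnegative after its removal, and for the amount of \<open>p\<close> absorbed
            by \<open>q\<close> not to exceed \<open>s\<close>.\<close>
          have "\<exists>d>0. d < 1 \<and> d * (1 - s) * r \<le> s * (1 - r) \<and> (\<forall>v\<in>W. d * k v \<le> l v)"
          proof -
            define c where "c = min (s * (1 - r) / ((1 - s) * r)) (Min (insert 1 (l ` W)))"
            have "finite W" using WA fin finite_subset by blast
            moreover have "0 < l v" if "v \<in> W" for v
              using that l(1) by (auto simp: W_def barycentric_def less_le)
            ultimately have "0 < Min (insert 1 (l ` W))"
              by (subst Min_gr_iff) auto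
            then have c: "0 < c"
              using 3 r r1 by (simp add: c_def)
            have "c \<le> s * (1 - r) / ((1 - s) * r)" by (simp add: c_def)
            then have cs: "c * (1 - s) * r \<le> s * (1 - r)"
              using 3 r(1) by (simp add: field_simps)
            have cl: "c \<le> 1" "\<And>v. v \<in> W \<Longrightarrow> c \<le> l v"
              using \<open>finite W\<close> by (auto simp: c_def min.coboundedI2)
            have k1: "k v \<le> 1" for v
            proof (cases "v \<in> A")
              case True
              then have "k v \<le> sum k A"
                using k(1) fin by (intro member_le_sum) (auto simp: barycentric_def)
              then show ?thesis using k(1) by (simp add: barycentric_def)
            next
              case False
              then have "k v = 0" using k(2) WA by blast
              then show ?thesis by simp
            qed
            have "c / 2 * k v \<le> l v" if v: "v \<in> W" for v
            proof -
              have "c / 2 * k v \<le> c / 2 * 1"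
                using c by (intro mult_left_mono k1) simp
              then show ?thesis using cl(2)[OF v] c by linarith
            qed
            moreover have "c / 2 * (1 - s) * r \<le> s * (1 - r)"
            proof -
              have "0 \<le> c * (1 - s) * r"
                using c 3 r(1) by (intro mult_nonneg_nonneg) auto
              then show ?thesis using cs by simp
            qed
            ultimately show ?thesis
              using c cl(1) by (intro exI[of _ "c / 2"]) simp
          qed
          then obtain d where d: "0 < d" "d < 1" "d * (1 - s) * r \<le> s * (1 - r)" "\<forall>v\<in>W. d * k v \<le> l v"
            by blast
          define z4 where "z4 = (1 / (1 - d)) *\<^sub>R (y - d *\<^sub>R z)"
          have z4: "y = (1 - d) *\<^sub>R z4 + d *\<^sub>R z"
            using d(2) by (simp add: z4_def)
          have "barycentric A z4 (\<lambda>v. (l v - d * k v) / (1 - d))"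
          proof -
            have nonneg: "0 \<le> l v - d * k v" for v
            proof (cases "v \<in> W")
              case True
              then show ?thesis using d(4) by simp
            next
              case False
              then have "k v = 0" "l v = 0" using k(2) by (auto simp: W_def)
              then show ?thesis by simp
            qed
            have "{v. (l v - d * k v) / (1 - d) \<noteq> 0} \<subseteq> W"
            proof
              fix v assume "v \<in> {v. (l v - d * k v) / (1 - d) \<noteq> 0}"
              then have "l v \<noteq> 0 \<or> k v \<noteq> 0" by auto
              then show "v \<in> W" using k(2) by (auto simp: W_def)
            qed
            moreover have "(\<Sum>v\<in>A. (l v - d * k v) / (1 - d)) = 1"
              using l(1) k(1) d(2)
              by (simp add: barycentric_def sum_divide_distrib[symmetric] sum_subtractf sum_distrib_left[symmetric])
            moreover have "(\<Sum>v\<in>A. ((l v - d * k v) / (1 - d)) *\<^sub>R v) = z4"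
            proof -
              have "(\<Sum>v\<in>A. ((l v - d * k v) / (1 - d)) *\<^sub>R v)
                = (1 / (1 - d)) *\<^sub>R ((\<Sum>v\<in>A. l v *\<^sub>R v) - d *\<^sub>R (\<Sum>v\<in>A. k v *\<^sub>R v))"
                by (simp add: scaleR_sum_right sum_subtractf[symmetric] scaleR_diff_left[symmetric])
              then show ?thesis
                using l(1) k(1) by (simp add: z4_def barycentric_def)
            qed
            ultimately show ?thesis
              using WA nonneg d(2) by (auto simp: barycentric_def)
          qed
          then have z4A: "z4 \<in> convex hull A"
            using convex_hull_barycentric[OF fin] by blast
          \<comment> \<open>The point \<open>q\<close> receives weight \<open>b\<close>. It replaces
            exactly the weight \<open>(1 - s) * d\<close> of \<open>z\<close> and the weight
            \<open>e\<close> of \<open>p\<close>.\<close>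
          define e where "e = (1 - s) * d * r / (1 - r)"
          have e: "0 < e" "e \<le> s"
            using 3 d r r1 by (auto simp: e_def field_simps)
          define b where "b = (1 - s) * d / (1 - r)"
          have b: "0 < b" "(1 - s) * (1 - d) + b = 1 - (s - e)" "b * (1 - r) = (1 - s) * d" "b * r = e"
            using 3 d r1 by (auto simp: b_def e_def field_simps)
          define c where "c = b / (1 - (s - e))"
          have s': "1 - (s - e) > 0" using 3 e by simp
          have c: "0 \<le> c" "c \<le> 1" "(1 - (s - e)) * c = b" "(1 - (s - e)) * (1 - c) = (1 - s) * (1 - d)"
          proof -
            have "(1 - s) * (1 - d) \<ge> 0" using 3 d by simp
            then show "0 \<le> c" "c \<le> 1" "(1 - (s - e)) * c = b" "(1 - (s - e)) * (1 - c) = (1 - s) * (1 - d)"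
              using b s' by (simp_all add: c_def right_diff_distrib)
          qed
          define y' where "y' = (1 - c) *\<^sub>R z4 + c *\<^sub>R q"
          have y': "y' \<in> convex hull A"
            unfolding y'_def using z4A r(3) c by (intro convexD[OF convex_convex_hull]) (auto simp: q_def)
          have "(1 - (s - e)) *\<^sub>R y' + (s - e) *\<^sub>R p
              = ((1 - s) * (1 - d)) *\<^sub>R z4 + b *\<^sub>R q + (s - e) *\<^sub>R p"
            unfolding y'_def scaleR_add_right scaleR_scaleR c(3,4) ..
          also have "b *\<^sub>R q = ((1 - s) * d) *\<^sub>R z + e *\<^sub>R p"
            unfolding q_def scaleR_add_right scaleR_scaleR b(3,4) ..
          also have "((1 - s) * (1 - d)) *\<^sub>R z4 + (((1 - s) * d) *\<^sub>R z + e *\<^sub>R p) + (s - e) *\<^sub>R p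
              = (1 - s) *\<^sub>R ((1 - d) *\<^sub>R z4 + d *\<^sub>R z) + s *\<^sub>R p"
            by (simp add: algebra_simps)
          finally have "x = (1 - (s - e)) *\<^sub>R y' + (s - e) *\<^sub>R p"
            using x z4 by simp
          then have "s \<le> s - e"
            using min[OF y'] e s by simp
          then show False using e by simp
        qed
        ultimately show ?thesis using l(2) unfolding \<S>'_def W_def by auto
      qed
    qed
    then show "\<exists>m. barycentric (insert p A) x m \<and> {v. m v \<noteq> 0} \<in> \<S>'"
      using m by blast
  qed
  then show ?thesis
    using that[of \<S>'] by (simp add: \<S>'_def)
qed

text \<open>The missing vertices are placed one after another. Each is an extreme point of
  \<open>P\<close>, hence outside the hull of those already present, and placing keeps all earlier
  cells.\<close>

lemma triangulating_extend:
  fixes P :: "'a::euclidean_space set"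
  assumes V: "finite (vertices_of P)" "convex P" and A: "A \<subseteq> vertices_of P" "A \<noteq> {}" and tri: "triangulating A \<S>"
  obtains \<S>' where "\<S> \<subseteq> \<S>'" "triangulating (vertices_of P) \<S>'"
proof -
  let ?V = "vertices_of P"
  have VP: "?V \<subseteq> P"
    by (auto simp: vertices_of_def extreme_point_of_def)
  have "\<exists>\<S>'. \<S> \<subseteq> \<S>' \<and> triangulating (A \<union> B) \<S>'" if "finite B" "B \<subseteq> ?V - A" for B
    using that
  proof (induction B)
    case empty
    then show ?case using tri by auto
  next
    case (insert b B)
    then obtain \<S>' where S': "\<S> \<subseteq> \<S>'" "triangulating (A \<union> B) \<S>'" by auto
    have "finite (A \<union> B)"
      using insert(1) finite_subset[OF A(1) V(1)] by simp
    moreover have "b \<notin> convex hull (A \<union> B)"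
      using insert(2,4) A(1) VP by (intro vertices_not_in_hull[OF V(2)]) auto
    moreover have "A \<union> B \<noteq> {}" using A(2) by simp
    ultimately obtain \<S>'' where "\<S>' \<subseteq> \<S>''" "triangulating (insert b (A \<union> B)) \<S>''"
      using triangulating_insert[OF S'(2)] by metis
    then show ?case
      using S'(1) by (intro exI[of _ \<S>'']) auto
  qed
  from this[of "?V - A"] V(1) A(1) show ?thesis
    using that by (auto simp: Un_absorb1)
qed

section \<open>A non-regular triangulation with eleven vertices\<close>

lemma barycentric_max_coeff:
  fixes A :: "'a::euclidean_space set"
  assumes "finite A" "p \<in> A" "barycentric A x l"
  obtains m where "barycentric A x m" "\<And>k. barycentric A x k \<Longrightarrow> k p \<le> m p"
proof -
  define T where "T = {t \<in> {0..1}. \<exists>z\<in>convex hull A. x = (1 - t) *\<^sub>R z + t *\<^sub>R p}"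
  have coeff: "k p \<in> T" if k: "barycentric A x k" for k
  proof -
    let ?A = "A - {p}"
    have A: "finite ?A" "p \<notin> ?A" "insert p ?A = A"
      using assms by auto
    have "barycentric (insert p ?A) x k"
      using k A(3) by simp
    with A(1,2) show ?thesis
    proof (cases rule: barycentric_insertE)
      case 1
      have "p \<in> convex hull A" using assms(2) by (rule hull_inc)
      then show ?thesis
        unfolding T_def using 1(1,2) by auto
    next
      case (2 m y)
      have "y \<in> convex hull A"
        using convex_hull_barycentric[OF A(1)] 2(3) hull_mono[of ?A A convex] by blast
      then show ?thesis
        unfolding T_def using 2(1,2,4) by (auto intro: less_imp_le)
    qed
  qed
  have "compact T"
    unfolding T_def by (rule compact_segment_parameters[OF finite_imp_compact_convex_hull[OF assms(1)]])
  moreover have "T \<noteq> {}"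
    using coeff[OF assms(3)] by blast
  ultimately obtain s where s: "s \<in> T" "\<forall>t\<in>T. t \<le> s"
    using compact_attains_sup by blast
  then obtain z where z: "z \<in> convex hull A" "x = (1 - s) *\<^sub>R z + s *\<^sub>R p" "0 \<le> s" "s \<le> 1"
    unfolding T_def by fastforce
  obtain n where n: "barycentric A z n"
    using z(1) convex_hull_barycentric[OF assms(1)] by blast
  \<comment> \<open>The coordinates \<open>n\<close> of \<open>z\<close> may use \<open>p\<close> as
    well. This only raises the coefficient above \<open>s\<close>, which already bounds all others,
    so it remains maximal.\<close>
  let ?m = "\<lambda>v. (1 - s) * n v + s * (if v = p then 1 else 0)"
  have m: "barycentric A x ?m"
    using barycentric_convex_comb[OF n barycentric_vertex[OF assms(1,2)] z(3,4)] z(2) by simp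
  moreover have "k p \<le> ?m p" if "barycentric A x k" for k
  proof -
    have "0 \<le> (1 - s) * n p"
      using n z(4) by (simp add: barycentric_def)
    then show ?thesis
      using s(2) coeff[OF that] by fastforce
  qed
  ultimately show ?thesis using that[of ?m] by blast
qed

text \<open>The ratio test of the simplex method: the step is the least quotient
  \<open>l v / (- d v)\<close> over the decreasing coordinates, and a coordinate attaining it
  becomes zero.\<close>

lemma exists_maximal_step:
  fixes l d :: "'a \<Rightarrow> real"
  assumes "finite A" "\<And>v. v \<in> A \<Longrightarrow> 0 \<le> l v" "\<exists>v\<in>A. d v < 0"
  obtains e v where "0 \<le> e" "\<forall>u\<in>A. 0 \<le> l u + e * d u" "v \<in> A" "d v < 0" "l v + e * d v = 0"
proof -
  let ?N = "{v \<in> A. d v < 0}"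
  have N: "finite ?N" "?N \<noteq> {}" using assms by auto
  define e where "e = Min ((\<lambda>v. l v / (- d v)) ` ?N)"
  have "e \<in> (\<lambda>v. l v / (- d v)) ` ?N"
    unfolding e_def using N by (intro Min_in) auto
  then obtain v where v: "v \<in> A" "d v < 0" "e = l v / (- d v)"
    by blast
  have e: "0 \<le> e"
    unfolding v(3) using v(1,2) assms(2) by (intro divide_nonneg_pos) auto
  have "0 \<le> l u + e * d u" if u: "u \<in> A" for u
  proof (cases "d u < 0")
    case True
    then have "e \<le> l u / (- d u)"
      unfolding e_def using N(1) u by (intro Min_le) auto
    then have "e * (- d u) \<le> l u"
      using True by (subst (asm) pos_le_divide_eq) auto
    then show ?thesis by simp
  next
    case False
    then show ?thesis using e assms(2)[OF u] by (intro add_nonneg_nonneg mult_nonneg_nonneg) auto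
  qed
  moreover have "l v + e * d v = 0"
    using v by simp
  ultimately show ?thesis
    using that e v(1,2) by blast
qed

text \<open>The assumption \<open>dependency\<close> makes the space of linear dependencies
  three-dimensional, with the coefficients at \<open>xp\<close>, \<open>yp\<close>,
  \<open>zp\<close> as parameters. The coefficients always add up to zero, so these are affine
  dependencies.\<close>

locale eleven_points =
  fixes xp xm yp ym zp zm a b c p q :: "'a::euclidean_space"
  assumes distinct: "distinct [xp, xm, yp, ym, zp, zm, a, b, c, p, q]"
    and relations: "xp + p + q = xm + b + c" "yp + p + q = ym + a + c" "zp + p + q = zm + a + b"
    and dependency: "\<And>u. (\<Sum>v\<in>{xp, xm, yp, ym, zp, zm, a, b, c, p, q}. u v *\<^sub>R v) = 0 \<Longrightarrow>
      u xm = - u xp \<and> u ym = - u yp \<and> u zm = - u zp \<and> u a = - (u yp + u zp) \<and> u b = - (u xp + u zp) \<and>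
      u c = - (u xp + u yp) \<and> u p = u xp + u yp + u zp \<and> u q = u xp + u yp + u zp"
begin

definition points :: "'a set" where
  "points = {xp, xm, yp, ym, zp, zm, a, b, c, p, q}"

text \<open>The complements of the maximal cells. The nine sets starting with \<open>{xm, a}\<close>, \<open>{ym, b}\<close> or \<open>{zm, c}\<close> come from the
  three ambiguous circuits, resolved cyclically.\<close>

definition blockers :: "'a set set" where
  "blockers = {{a, b, c}, {xm, ym, zm}, {xp, b, c}, {yp, a, c}, {zp, a, b},
     {xm, a, ym}, {xm, a, zp}, {xm, a, c}, {ym, b, zm}, {ym, b, xp}, {ym, b, a},
     {zm, c, xm}, {zm, c, yp}, {zm, c, b}}"

definition cells :: "'a set set" where
  "cells = {W. W \<subseteq> points \<and> (\<exists>B\<in>blockers. W \<inter> B = {})}"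

section \<open>Coordinates of a point as a polytope in the three parameters of the
  dependencies\<close>

lemma finite_points: "finite points"
  by (simp add: points_def)

lemma ball_points: "(\<forall>v\<in>points. Q v) \<longleftrightarrow>
    Q xp \<and> Q xm \<and> Q yp \<and> Q ym \<and> Q zp \<and> Q zm \<and> Q a \<and> Q b \<and> Q c \<and> Q p \<and> Q q"
  by (simp add: points_def)

lemma sum_points: "(\<Sum>v\<in>points. f v) =
    f xp + f xm + f yp + f ym + f zp + f zm + f a + f b + f c + f p + f q"
  using distinct by (simp add: points_def add.assoc)

text \<open>The combination of the three relations with factors \<open>r\<close>, \<open>s\<close>,
  \<open>t\<close>. Adding multiples of it changes the coordinates of a point but not the point, and
  the coefficient of \<open>p\<close> grows at rate \<open>r + s + t\<close>.\<close>

definition dir :: "real \<Rightarrow> real \<Rightarrow> real \<Rightarrow> 'a \<Rightarrow> real" where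
  "dir r s t v = (if v = xp then r else if v = xm then - r else if v = yp then s else if v = ym then - s
     else if v = zp then t else if v = zm then - t else if v = a then - (s + t) else if v = b then - (r + t)
     else if v = c then - (r + s) else if v = p \<or> v = q then r + s + t else 0)"

lemma dir_simps:
  "dir r s t xp = r" "dir r s t xm = - r" "dir r s t yp = s" "dir r s t ym = - s" "dir r s t zp = t"
  "dir r s t zm = - t" "dir r s t a = - (s + t)" "dir r s t b = - (r + t)" "dir r s t c = - (r + s)"
  "dir r s t p = r + s + t" "dir r s t q = r + s + t"
  using distinct by (auto simp: dir_def)

lemma dir_outside: "v \<notin> points \<Longrightarrow> dir r s t v = 0"
  by (auto simp: points_def dir_def)

lemma barycentric_dir:
  assumes "barycentric points x l" "\<forall>v\<in>points. 0 \<le> l v + e * dir r s t v"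
  shows "barycentric points x (\<lambda>v. l v + e * dir r s t v)"
proof -
  have out: "l v + e * dir r s t v = 0" if "v \<notin> points" for v
    using that assms(1) dir_outside[OF that] by (auto simp: barycentric_def)
  have "(\<Sum>v\<in>points. dir r s t v) = 0"
    unfolding sum_points dir_simps by simp
  moreover have "(\<Sum>v\<in>points. dir r s t v *\<^sub>R v)
      = r *\<^sub>R ((xp + p + q) - (xm + b + c)) + s *\<^sub>R ((yp + p + q) - (ym + a + c)) + t *\<^sub>R ((zp + p + q) - (zm + a + b))"
    unfolding sum_points dir_simps by (simp add: algebra_simps)
  then have "(\<Sum>v\<in>points. dir r s t v *\<^sub>R v) = 0"
    unfolding relations by simp
  ultimately have "sum (\<lambda>v. l v + e * dir r s t v) points = 1"
    "(\<Sum>v\<in>points. (l v + e * dir r s t v) *\<^sub>R v) = x"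
    using assms(1)
    by (simp_all add: barycentric_def sum.distrib sum_distrib_left[symmetric] scaleR_add_left
        scaleR_scaleR[symmetric] scaleR_sum_right[symmetric] del: scaleR_scaleR)
  moreover have "0 \<le> l v + e * dir r s t v" for v
    using assms(2) out by (cases "v \<in> points") auto
  moreover have "{v. l v + e * dir r s t v \<noteq> 0} \<subseteq> points"
    using out by blast
  ultimately show ?thesis
    unfolding barycentric_def by blast
qed

lemma cells_iff:
  assumes "{v. l v \<noteq> (0::real)} \<subseteq> points"
  shows "{v. l v \<noteq> 0} \<in> cells \<longleftrightarrow> (\<exists>B\<in>blockers. \<forall>v\<in>B. l v = 0)"
  unfolding cells_def using assms by (auto simp: disjoint_iff)

text \<open>The difference \<open>u\<close> of the two coordinate systems is a dependency. It is
  nonpositive on a blocker where \<open>l\<close> vanishes and nonnegative on a blocker where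
  \<open>m\<close> vanishes; every pair of blockers leaves only the zero dependency.\<close>

lemma cells_unique:
  assumes l: "barycentric points x l" "{v. l v \<noteq> 0} \<in> cells"
    and m: "barycentric points x m" "{v. m v \<noteq> 0} \<in> cells"
  shows "l = m"
proof -
  define u where "u v = l v - m v" for v
  have nonneg: "0 \<le> l v" "0 \<le> m v" for v
    using l(1) m(1) by (auto simp: barycentric_def)
  have sub: "{v. l v \<noteq> 0} \<subseteq> points" "{v. m v \<noteq> 0} \<subseteq> points"
    using l(1) m(1) by (auto simp: barycentric_def)
  obtain B where B: "B \<in> blockers" "\<forall>v\<in>B. l v = 0"
    using l(2) cells_iff[OF sub(1)] by blast
  obtain C where C: "C \<in> blockers" "\<forall>v\<in>C. m v = 0"
    using m(2) cells_iff[OF sub(2)] by blast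
  have le: "\<forall>v\<in>B. u v \<le> 0"
    using B(2) nonneg(2) by (simp add: u_def)
  have ge: "\<forall>v\<in>C. 0 \<le> u v"
    using C(2) nonneg(1) by (simp add: u_def)
  have "(\<Sum>v\<in>points. u v *\<^sub>R v) = 0"
    using l(1) m(1) by (simp add: u_def barycentric_def scaleR_diff_left sum_subtractf)
  then have u: "u xm = - u xp" "u ym = - u yp" "u zm = - u zp" "u a = - (u yp + u zp)"
    "u b = - (u xp + u zp)" "u c = - (u xp + u yp)" "u p = u xp + u yp + u zp" "u q = u xp + u yp + u zp"
    using dependency[of u] unfolding points_def by simp_all
  \<comment> \<open>One small linear system in \<open>u xp\<close>, \<open>u yp\<close>,
    \<open>u zp\<close> for each of the 14 times 14 pairs of blockers.\<close>
  have "u xp = 0 \<and> u yp = 0 \<and> u zp = 0"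
    using B(1) C(1) le ge unfolding blockers_def
    by (elim insertE emptyE; simp add: u; linarith)
  then have "\<forall>v\<in>points. u v = 0"
    unfolding ball_points using u by simp
  moreover have "u v = 0" if "v \<notin> points" for v
  proof -
    have "l v = 0" "m v = 0" using that sub by blast+
    then show ?thesis by (simp add: u_def)
  qed
  ultimately have "u v = 0" for v by blast
  then show ?thesis
    by (auto simp: u_def fun_eq_iff)
qed

text \<open>Start from coordinates with the largest coefficient of \<open>p\<close>. Every direction
  that would increase it is obstructed by a vanishing coefficient; six such directions already yield
  a blocker or one of three ambiguous pairs of zeros. An ambiguous pair is completed to a blocker by
  sliding along its circuit, which leaves the coefficient of \<open>p\<close> unchanged.\<close>

lemma cells_exists:
  assumes "barycentric points x l0"
  shows "\<exists>m. barycentric points x m \<and> {v. m v \<noteq> 0} \<in> cells"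
proof -
  have p: "p \<in> points" by (simp add: points_def)
  obtain l where l: "barycentric points x l" and max: "\<And>k. barycentric points x k \<Longrightarrow> k p \<le> l p"
    using barycentric_max_coeff[OF finite_points p assms] by blast
  have nonneg: "0 \<le> l v" for v
    using l by (simp add: barycentric_def)
  \<comment> \<open>A positive step would raise the maximal coefficient of \<open>p\<close>, so the
    largest admissible step is zero and some decreasing coefficient vanishes from the start.\<close>
  have blocked: "\<exists>v\<in>points. dir r s t v < 0 \<and> l v = 0" if pos: "0 < r + s + t" and neg: "\<exists>v\<in>points. dir r s t v < 0" for r s t
  proof -
    obtain e v where e: "0 \<le> e" "\<forall>u\<in>points. 0 \<le> l u + e * dir r s t u"
      "v \<in> points" "dir r s t v < 0" "l v + e * dir r s t v = 0"
      by (rule exists_maximal_step[OF finite_points nonneg neg])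
    have "l p + e * (r + s + t) \<le> l p"
      using max[OF barycentric_dir[OF l e(2)]] by (simp only: dir_simps)
    then have "e = 0"
      using e(1) pos by (simp add: mult_le_0_iff)
    then show ?thesis using e(3-5) by auto
  qed
  have slide: "\<exists>m. barycentric points x m \<and> (\<forall>u. l u = 0 \<longrightarrow> dir r s t u = 0 \<longrightarrow> m u = 0) \<and>
      (\<exists>v\<in>points. dir r s t v < 0 \<and> m v = 0)" if neg: "\<exists>v\<in>points. dir r s t v < 0" for r s t
  proof -
    obtain e v where e: "0 \<le> e" "\<forall>u\<in>points. 0 \<le> l u + e * dir r s t u"
      "v \<in> points" "dir r s t v < 0" "l v + e * dir r s t v = 0"
      by (rule exists_maximal_step[OF finite_points nonneg neg])
    show ?thesis
      using barycentric_dir[OF l e(2)] e(3-5)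
      by (intro exI[of _ "\<lambda>v. l v + e * dir r s t v"] conjI bexI[of _ v]) simp_all
  qed
  have bex: "(\<exists>v\<in>points. Q v) \<longleftrightarrow>
    Q xp \<or> Q xm \<or> Q yp \<or> Q ym \<or> Q zp \<or> Q zm \<or> Q a \<or> Q b \<or> Q c \<or> Q p \<or> Q q" for Q
    by (simp add: points_def)
  have done': ?thesis if m: "barycentric points x m" "\<exists>B\<in>blockers. \<forall>v\<in>B. m v = 0" for m
  proof -
    have "{v. m v \<noteq> 0} \<in> cells"
      using m cells_iff[of m] by (simp add: barycentric_def)
    then show ?thesis using m(1) by blast
  qed
  have "l xm = 0 \<or> l b = 0 \<or> l c = 0"
    using blocked[of 1 0 0] by (simp add: bex dir_simps)
  moreover have "l ym = 0 \<or> l a = 0 \<or> l c = 0"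
    using blocked[of 0 1 0] by (simp add: bex dir_simps)
  moreover have "l zm = 0 \<or> l a = 0 \<or> l b = 0"
    using blocked[of 0 0 1] by (simp add: bex dir_simps)
  \<comment> \<open>In the mixed directions two of the coefficients at \<open>a\<close>,
    \<open>b\<close>, \<open>c\<close> cancel, which gives shorter lists of possible zeros.\<close>
  moreover have "l xm = 0 \<or> l ym = 0 \<or> l zp = 0 \<or> l c = 0"
    using blocked[of 1 1 "-1"] by (simp add: bex dir_simps)
  moreover have "l xm = 0 \<or> l yp = 0 \<or> l zm = 0 \<or> l b = 0"
    using blocked[of 1 "-1" 1] by (simp add: bex dir_simps)
  moreover have "l xp = 0 \<or> l ym = 0 \<or> l zm = 0 \<or> l a = 0"
    using blocked[of "-1" 1 1] by (simp add: bex dir_simps)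
  ultimately have "(\<exists>B\<in>blockers. \<forall>v\<in>B. l v = 0) \<or>
      (l xm = 0 \<and> l a = 0) \<or> (l ym = 0 \<and> l b = 0) \<or> (l zm = 0 \<and> l c = 0)"
    unfolding blockers_def bex_simps ball_simps by satx
  then consider "\<exists>B\<in>blockers. \<forall>v\<in>B. l v = 0" | "l xm = 0 \<and> l a = 0" | "l ym = 0 \<and> l b = 0" |
      "l zm = 0 \<and> l c = 0"
    by satx
  then show ?thesis
  proof cases
    case 1
    then show ?thesis using done' l by blast
  next
    case 2
    \<comment> \<open>This direction moves weight from \<open>ym\<close>, \<open>zp\<close>,
      \<open>c\<close> to \<open>yp\<close>, \<open>zm\<close>, \<open>b\<close> and keeps the zeros
      at \<open>xm\<close> and \<open>a\<close>. Whichever of the first three vanishes completes a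
      blocker, so the triple \<open>yp\<close>, \<open>zm\<close>, \<open>b\<close> is the one kept
      as a cell. The other two cases are its cyclic images.\<close>
    have "\<exists>v\<in>points. dir 0 1 (-1) v < 0"
      unfolding bex dir_simps by simp
    from slide[OF this] obtain m where m: "barycentric points x m"
      "\<forall>u. l u = 0 \<longrightarrow> dir 0 1 (-1) u = 0 \<longrightarrow> m u = 0" "\<exists>v\<in>points. dir 0 1 (-1) v < 0 \<and> m v = 0"
      by (elim exE conjE)
    have "m xm = 0" "m a = 0"
      using m(2) 2 by (simp_all add: dir_simps)
    moreover have "m ym = 0 \<or> m zp = 0 \<or> m c = 0"
      using m(3) by (simp add: bex dir_simps disj_commute disj_left_commute)
    ultimately have "\<exists>B\<in>blockers. \<forall>v\<in>B. m v = 0"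
      unfolding blockers_def bex_simps ball_simps by satx
    then show ?thesis
      by (rule done'[OF m(1)])
  next
    case 3
    have "\<exists>v\<in>points. dir (-1) 0 1 v < 0"
      unfolding bex dir_simps by simp
    from slide[OF this] obtain m where m: "barycentric points x m"
      "\<forall>u. l u = 0 \<longrightarrow> dir (-1) 0 1 u = 0 \<longrightarrow> m u = 0" "\<exists>v\<in>points. dir (-1) 0 1 v < 0 \<and> m v = 0"
      by (elim exE conjE)
    have "m ym = 0" "m b = 0"
      using m(2) 3 by (simp_all add: dir_simps)
    moreover have "m zm = 0 \<or> m xp = 0 \<or> m a = 0"
      using m(3) by (simp add: bex dir_simps disj_commute disj_left_commute)
    ultimately have "\<exists>B\<in>blockers. \<forall>v\<in>B. m v = 0"
      unfolding blockers_def bex_simps ball_simps by satx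
    then show ?thesis
      by (rule done'[OF m(1)])
  next
    case 4
    have "\<exists>v\<in>points. dir 1 (-1) 0 v < 0"
      unfolding bex dir_simps by simp
    from slide[OF this] obtain m where m: "barycentric points x m"
      "\<forall>u. l u = 0 \<longrightarrow> dir 1 (-1) 0 u = 0 \<longrightarrow> m u = 0" "\<exists>v\<in>points. dir 1 (-1) 0 v < 0 \<and> m v = 0"
      by (elim exE conjE)
    have "m zm = 0" "m c = 0"
      using m(2) 4 by (simp_all add: dir_simps)
    moreover have "m xm = 0 \<or> m yp = 0 \<or> m b = 0"
      using m(3) by (simp add: bex dir_simps disj_commute disj_left_commute)
    ultimately have "\<exists>B\<in>blockers. \<forall>v\<in>B. m v = 0"
      unfolding blockers_def bex_simps ball_simps by satx
    then show ?thesis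
      by (rule done'[OF m(1)])
  qed
qed

lemma triangulating_cells: "triangulating points cells"
proof (rule triangulatingI)
  show "cells \<subseteq> Pow points" "{} \<in> cells"
    by (auto simp: cells_def blockers_def)
  show "U \<in> cells" if "W \<in> cells" "U \<subseteq> W" for W U
    using that unfolding cells_def by blast
  show "\<exists>m. barycentric points x m \<and> {v. m v \<noteq> 0} \<in> cells" if "barycentric points x l" for x l
    using cells_exists[OF that] by blast
qed (use finite_points cells_unique in auto)

text \<open>The cells on the eleven points survive the extension to all vertices, so a weight
  inducing the extended triangulation would satisfy the three cyclic inequalities, whose sum is
  contradictory.\<close>

lemma exists_nonregular_triangulation:
  assumes P: "finite (vertices_of P)" "convex hull vertices_of P = P" and sub: "points \<subseteq> vertices_of P"
  shows "\<exists>\<T>. polytope_triangulation P \<T> \<and> \<not> regular_triangulation P \<T>"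
proof -
  have "convex P" using P(2) convex_convex_hull by metis
  moreover have "points \<noteq> {}" by (simp add: points_def)
  ultimately obtain \<S> where S: "cells \<subseteq> \<S>" "triangulating (vertices_of P) \<S>"
    using triangulating_extend[OF P(1) _ sub _ triangulating_cells] by blast
  let ?T = "(\<lambda>W. convex hull W) ` \<S>"
  have "\<not> regular_triangulation P ?T"
  proof
    assume "regular_triangulation P ?T"
    then obtain w where w: "?T = projected_lower_envelope (vertices_of P) w"
      by (auto simp: regular_triangulation_def regular_over_def)
    have cell: "convex hull W \<in> projected_lower_envelope (vertices_of P) w" if "W \<in> cells" for W
      unfolding w[symmetric] using that S(1) by blast
    have "{yp, zm, b} \<in> cells" "{zp, xm, c} \<in> cells" "{xp, ym, a} \<in> cells"
      using distinct by (auto simp: cells_def blockers_def points_def)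
    note cells = this[THEN cell]
    \<comment> \<open>Adding one relation to the reverse of another cancels \<open>p\<close>,
      \<open>q\<close> and the point \<open>r\<close> that both share, which produces the ambiguous
      circuits.\<close>
    have cross: "x1 + z2 + s2 = x2 + z1 + s1"
      if rel: "x1 + p + q = x2 + r + s1" "z1 + p + q = z2 + r + s2" for x1 x2 z1 z2 r s1 s2
    proof -
      have "(x1 + z2 + s2) + (r + p + q) = (x1 + p + q) + (z2 + r + s2)"
        by (simp add: ac_simps)
      also have "\<dots> = (x2 + r + s1) + (z1 + p + q)"
        by (rule arg_cong2[of _ _ _ _ "(+)", OF rel(1) rel(2)[symmetric]])
      also have "\<dots> = (x2 + z1 + s1) + (r + p + q)"
        by (simp add: ac_simps)
      finally show ?thesis by simp
    qed
    have eqs: "yp + zm + b = ym + zp + c" "zp + xm + c = zm + xp + a" "xp + ym + a = xm + yp + b"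
      by (rule cross[of yp ym a c zp zm b] cross[of zp zm b a xp xm c] cross[of xp xm c b yp ym a];
          use relations in \<open>simp add: ac_simps\<close>)+
    have sub': "{yp, zm, b, ym, zp, c} \<subseteq> vertices_of P" "{zp, xm, c, zm, xp, a} \<subseteq> vertices_of P"
      "{xp, ym, a, xm, yp, b} \<subseteq> vertices_of P"
      using sub by (auto simp: points_def)
    have dist: "distinct [yp, zm, b, ym, zp, c]" "distinct [zp, xm, c, zm, xp, a]" "distinct [xp, ym, a, xm, yp, b]"
      using distinct by auto
    note less = projected_lower_envelope_less_triple[OF P]
    have "w yp + w zm + w b < w ym + w zp + w c" "w zp + w xm + w c < w zm + w xp + w a"
      "w xp + w ym + w a < w xm + w yp + w b"
      using less[OF sub'(1) dist(1) cells(1) eqs(1)] less[OF sub'(2) dist(2) cells(2) eqs(2)]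
        less[OF sub'(3) dist(3) cells(3) eqs(3)] .
    then show False by linarith
  qed
  then show ?thesis
    using triangulating_imp_polytope_triangulation[OF S(2) P] by blast
qed

end

section \<open>Birkhoff polytopes\<close>

text \<open>Entries, row sums and column sums are inner products with fixed matrices, so the set is
  a finite intersection of half-spaces and hyperplanes. It is bounded because each row has absolute
  sum 1.\<close>

lemma polytope_birkhoff: "polytope (birkhoff_polytope :: (real ^ 'p ^ 'p) set)"
proof -
  let ?B = "birkhoff_polytope :: (real ^ 'p ^ 'p) set"
  have row: "axis i 1 \<bullet> M = (\<Sum>j\<in>UNIV. M $ i $ j)" for i and M :: "real ^ 'p ^ 'p"
    unfolding inner_axis' by (simp add: inner_vec_def)
  have col: "(\<chi> i. axis j 1) \<bullet> M = (\<Sum>i\<in>UNIV. M $ i $ j)" for j and M :: "real ^ 'p ^ 'p"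
    unfolding inner_vec_def[of _ M] by (simp add: inner_axis')
  have entry: "axis i (axis j 1) \<bullet> M = M $ i $ j" for i j and M :: "real ^ 'p ^ 'p"
    by (simp add: inner_axis')
  have "?B = (\<Inter>i. \<Inter>j. {M. axis i (axis j 1) \<bullet> M \<ge> 0}) \<inter>
      (\<Inter>i. {M. axis i 1 \<bullet> M = 1}) \<inter> (\<Inter>j. {M. (\<chi> i. axis j 1) \<bullet> M = 1})"
    unfolding row col entry by (auto simp: birkhoff_polytope_def)
  also have "polyhedron \<dots>"
    by (intro polyhedron_Int polyhedron_Inter ballI finite_imageI finite)
      (auto intro!: polyhedron_Inter simp: polyhedron_halfspace_ge polyhedron_hyperplane)
  finally have "polyhedron ?B" .
  moreover have "norm M \<le> real CARD('p)" if M: "M \<in> ?B" for M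
  proof -
    have "norm M \<le> (\<Sum>i\<in>UNIV. norm (M $ i))"
      unfolding norm_vec_def[of M] by (rule L2_set_le_sum) simp
    also have "\<dots> \<le> (\<Sum>i\<in>(UNIV::'p set). 1)"
    proof (rule sum_mono)
      fix i
      have "norm (M $ i) \<le> (\<Sum>j\<in>UNIV. \<bar>M $ i $ j\<bar>)"
        by (rule norm_le_l1_cart)
      also have "\<dots> = 1"
        using M by (simp add: birkhoff_polytope_def)
      finally show "norm (M $ i) \<le> 1" .
    qed
    finally show ?thesis by simp
  qed
  then have "bounded ?B"
    unfolding bounded_iff by blast
  ultimately show ?thesis
    by (simp add: polytope_eq_bounded_polyhedron)
qed

section \<open>Vertices of polytopes and permutation matrices\<close>

lemma finite_vertices_polytope:
  fixes P :: "'a::euclidean_space set"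
  shows "polytope P \<Longrightarrow> finite (vertices_of P)"
  unfolding vertices_of_def by (intro finite_polyhedron_extreme_points polytope_imp_polyhedron)

lemma convex_hull_vertices_polytope:
  fixes P :: "'a::euclidean_space set"
  shows "polytope P \<Longrightarrow> convex hull vertices_of P = P"
  unfolding vertices_of_def
  by (rule Krein_Milman_Minkowski[symmetric]) (auto simp: polytope_imp_compact polytope_imp_convex)

definition permutation_matrix :: "('p::finite \<Rightarrow> 'p) \<Rightarrow> real ^ 'p ^ 'p" where
  "permutation_matrix f = (\<chi> i j. if f i = j then 1 else 0)"

text \<open>All entries in the polytope lie between 0 and 1, and a permutation matrix has only the
  extreme values 0 and 1. So the ends of a segment through it must agree with it in every
  entry.\<close>

lemma permutation_matrix_vertex:
  assumes "bij f"
  shows "permutation_matrix f \<in> vertices_of birkhoff_polytope"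
proof -
  let ?M = "permutation_matrix f"
  have col: "(\<Sum>i\<in>UNIV. if f i = j then 1 else (0::real)) = 1" for j
  proof -
    have "f i = j \<longleftrightarrow> i = inv f j" for i
      using assms by (metis bij_inv_eq_iff)
    then show ?thesis by simp
  qed
  have M: "?M \<in> birkhoff_polytope"
    by (simp add: birkhoff_polytope_def permutation_matrix_def col)
  have le1: "N $ i $ j \<le> 1" if "N \<in> birkhoff_polytope" for N i j
  proof -
    have "N $ i $ j \<le> (\<Sum>j\<in>UNIV. N $ i $ j)"
      using that by (intro member_le_sum) (auto simp: birkhoff_polytope_def)
    then show ?thesis using that by (simp add: birkhoff_polytope_def)
  qed
  have "?M \<notin> open_segment A B" if A: "A \<in> birkhoff_polytope" and B: "B \<in> birkhoff_polytope" for A B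
  proof
    assume seg: "?M \<in> open_segment A B"
    then obtain t where t: "0 < t" "t < 1" "?M = (1 - t) *\<^sub>R A + t *\<^sub>R B" and ne: "A \<noteq> B"
      by (auto simp: in_segment)
    have "A $ i $ j = B $ i $ j" for i j
    proof -
      have eq: "?M $ i $ j = (1 - t) * A $ i $ j + t * B $ i $ j"
        using t(3) by simp
      have b: "0 \<le> A $ i $ j" "0 \<le> B $ i $ j" "A $ i $ j \<le> 1" "B $ i $ j \<le> 1"
        using A B le1 by (auto simp: birkhoff_polytope_def)
      show ?thesis
      proof (cases "f i = j")
        case True
        then have "(1 - t) * (1 - A $ i $ j) + t * (1 - B $ i $ j) = 0"
          using eq by (simp add: permutation_matrix_def algebra_simps)
        moreover have "0 \<le> (1 - t) * (1 - A $ i $ j)" "0 \<le> t * (1 - B $ i $ j)"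
          using t b by auto
        ultimately have "(1 - t) * (1 - A $ i $ j) = 0" "t * (1 - B $ i $ j) = 0"
          by linarith+
        then show ?thesis using t by simp
      next
        case False
        then have "(1 - t) * A $ i $ j + t * B $ i $ j = 0"
          using eq by (simp add: permutation_matrix_def)
        moreover have "0 \<le> (1 - t) * A $ i $ j" "0 \<le> t * B $ i $ j"
          using t b by auto
        ultimately have "(1 - t) * A $ i $ j = 0" "t * B $ i $ j = 0"
          by linarith+
        then show ?thesis using t by simp
      qed
    qed
    then show False using ne by (simp add: vec_eq_iff)
  qed
  then show ?thesis
    using M by (simp add: vertices_of_def extreme_point_of_def)
qed

lemma birkhoff_exists_nonregular:
  assumes "CARD('p::finite) \<ge> 4"
  shows "\<exists>\<T>. polytope_triangulation (birkhoff_polytope :: (real ^ 'p ^ 'p) set) \<T> \<and>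
    \<not> regular_triangulation (birkhoff_polytope :: (real ^ 'p ^ 'p) set) \<T>"
proof -
  obtain S :: "'p set" where "card S = 4"
    using obtain_subset_with_card_n[OF assms] by blast
  then obtain e1 e2 e3 e4 :: 'p where e: "distinct [e1, e2, e3, e4]"
    by (auto simp: card_Suc_eq numeral_eq_Suc)
  define M where "M i j k l = permutation_matrix (id(e1 := i, e2 := j, e3 := k, e4 := l))" for i j k l
  have M: "M i j k l $ e1 $ x = (if i = x then 1 else 0)" "M i j k l $ e2 $ x = (if j = x then 1 else 0)"
    "M i j k l $ e3 $ x = (if k = x then 1 else 0)" "M i j k l $ e4 $ x = (if l = x then 1 else 0)"
    "y \<notin> {e1, e2, e3, e4} \<Longrightarrow> M i j k l $ y $ x = (if y = x then 1 else 0)" for i j k l x y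
    using e by (auto simp: M_def permutation_matrix_def)
  have ne: "e1 \<noteq> e2" "e1 \<noteq> e3" "e1 \<noteq> e4" "e2 \<noteq> e3" "e2 \<noteq> e4" "e3 \<noteq> e4"
    "e2 \<noteq> e1" "e3 \<noteq> e1" "e4 \<noteq> e1" "e3 \<noteq> e2" "e4 \<noteq> e2" "e4 \<noteq> e3"
    using e by auto
  have vertex: "M i j k l \<in> vertices_of birkhoff_polytope" if "{i, j, k, l} = {e1, e2, e3, e4}" for i j k l
  proof -
    let ?f = "id(e1 := i, e2 := j, e3 := k, e4 := l)"
    have "\<exists>x. ?f x = y" for y
    proof (cases "y \<in> {i, j, k, l}")
      case True
      then consider "y = i" | "y = j" | "y = k" | "y = l" by blast
      then show ?thesis
      proof cases
        case 1 then show ?thesis using ne by (intro exI[of _ e1]) simp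
      next
        case 2 then show ?thesis using ne by (intro exI[of _ e2]) simp
      next
        case 3 then show ?thesis using ne by (intro exI[of _ e3]) simp
      next
        case 4 then show ?thesis by (intro exI[of _ e4]) simp
      qed
    next
      case False
      then have "y \<notin> {e1, e2, e3, e4}" using that by simp
      then show ?thesis by (intro exI[of _ y]) simp
    qed
    then have "surj ?f" by (metis surjI)
    then have "bij ?f" by (simp add: bij_def finite_UNIV_surj_inj)
    then show ?thesis unfolding M_def by (rule permutation_matrix_vertex)
  qed
  let ?xp = "M e2 e4 e3 e1" and ?xm = "M e2 e3 e4 e1" and ?yp = "M e3 e4 e1 e2" and ?ym = "M e3 e2 e1 e4"
    and ?zp = "M e4 e1 e3 e2" and ?zm = "M e4 e1 e2 e3" and ?a = "M e1 e3 e4 e2" and ?b = "M e1 e2 e3 e4"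
    and ?c = "M e1 e4 e2 e3" and ?p = "M e1 e2 e4 e3" and ?q = "M e1 e3 e2 e4"
  have rel: "X = Y" if "\<And>j. X $ e1 $ j = Y $ e1 $ j" "\<And>j. X $ e2 $ j = Y $ e2 $ j"
    "\<And>j. X $ e3 $ j = Y $ e3 $ j" "\<And>j. X $ e4 $ j = Y $ e4 $ j"
    "\<And>i j. i \<notin> {e1, e2, e3, e4} \<Longrightarrow> X $ i $ j = Y $ i $ j" for X Y :: "real ^ 'p ^ 'p"
    unfolding vec_eq_iff using that by (metis insert_iff singletonD)
  interpret eleven_points ?xp ?xm ?yp ?ym ?zp ?zm ?a ?b ?c ?p ?q
  proof
    let ?L = "[?xp, ?xm, ?yp, ?ym, ?zp, ?zm, ?a, ?b, ?c, ?p, ?q]"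
    \<comment> \<open>Distinctness is tested on eight entries, which already tell the eleven
      matrices apart.\<close>
    have "distinct (map (\<lambda>N. (N $ e1 $ e1, N $ e1 $ e2, N $ e1 $ e3, N $ e2 $ e1, N $ e2 $ e2, N $ e2 $ e3, N $ e3 $ e3, N $ e3 $ e2)) ?L)"
      by (simp add: M ne)
    then show dist: "distinct ?L" by (rule distinct_map[THEN iffD1, THEN conjunct1])
    show "?xp + ?p + ?q = ?xm + ?b + ?c" "?yp + ?p + ?q = ?ym + ?a + ?c" "?zp + ?p + ?q = ?zm + ?a + ?b"
      by (rule rel; simp add: M ac_simps)+
    fix u :: "real ^ 'p ^ 'p \<Rightarrow> real"
    assume u: "(\<Sum>v\<in>{?xp, ?xm, ?yp, ?ym, ?zp, ?zm, ?a, ?b, ?c, ?p, ?q}. u v *\<^sub>R v) = 0"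
    have sum: "u ?xp *\<^sub>R ?xp + u ?xm *\<^sub>R ?xm + u ?yp *\<^sub>R ?yp + u ?ym *\<^sub>R ?ym + u ?zp *\<^sub>R ?zp + u ?zm *\<^sub>R ?zm
      + u ?a *\<^sub>R ?a + u ?b *\<^sub>R ?b + u ?c *\<^sub>R ?c + u ?p *\<^sub>R ?p + u ?q *\<^sub>R ?q = 0"
      using u dist by (simp add: add.assoc)
    have E: "u ?xp * ?xp $ i $ j + u ?xm * ?xm $ i $ j + u ?yp * ?yp $ i $ j + u ?ym * ?ym $ i $ j
      + u ?zp * ?zp $ i $ j + u ?zm * ?zm $ i $ j + u ?a * ?a $ i $ j + u ?b * ?b $ i $ j + u ?c * ?c $ i $ j
      + u ?p * ?p $ i $ j + u ?q * ?q $ i $ j = 0" for i j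
      using arg_cong[OF sum, of "\<lambda>N. N $ i $ j"]
      by (simp only: vector_add_component vector_scaleR_component real_scaleR_def zero_index)
    \<comment> \<open>Read off in columns \<open>e2\<close>, \<open>e3\<close>, \<open>e4\<close> of
      the four distinguished rows, the dependency becomes twelve short equations that determine
      everything from three coefficients.\<close>
    have "u ?xp + u ?xm = 0" "u ?yp + u ?ym = 0" "u ?zp + u ?zm = 0"
      using E[of e1 e2] E[of e1 e3] E[of e1 e4] by (simp_all add: M ne)
    moreover have "u ?ym + u ?b + u ?p = 0" "u ?xm + u ?a + u ?q = 0" "u ?xp + u ?yp + u ?c = 0"
      using E[of e2 e2] E[of e2 e3] E[of e2 e4] by (simp_all add: M ne)
    moreover have "u ?zm + u ?c + u ?q = 0" "u ?xp + u ?zp + u ?b = 0" "u ?xm + u ?a + u ?p = 0"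
      using E[of e3 e2] E[of e3 e3] E[of e3 e4] by (simp_all add: M ne)
    moreover have "u ?yp + u ?zp + u ?a = 0" "u ?zm + u ?c + u ?p = 0" "u ?ym + u ?b + u ?q = 0"
      using E[of e4 e2] E[of e4 e3] E[of e4 e4] by (simp_all add: M ne)
    ultimately show "u ?xm = - u ?xp \<and> u ?ym = - u ?yp \<and> u ?zm = - u ?zp \<and> u ?a = - (u ?yp + u ?zp) \<and>
      u ?b = - (u ?xp + u ?zp) \<and> u ?c = - (u ?xp + u ?yp) \<and> u ?p = u ?xp + u ?yp + u ?zp \<and>
      u ?q = u ?xp + u ?yp + u ?zp"
      by linarith
  qed
  show ?thesis
  proof (rule exists_nonregular_triangulation)
    show "points \<subseteq> vertices_of birkhoff_polytope"
      unfolding points_def by (intro insert_subsetI empty_subsetI vertex) auto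
  qed (simp_all add: finite_vertices_polytope convex_hull_vertices_polytope polytope_birkhoff)
qed

section \<open>Polytopes with at most one affine dependency among their vertices\<close>

lemma polytope_triangulation_cell:
  assumes "polytope_triangulation P \<T>" "S \<in> \<T>"
  shows "S = convex hull vertices_of S" "\<not> affine_dependent (vertices_of S)"
    "vertices_of S \<subseteq> vertices_of P" "S \<subseteq> P" "\<And>F. F face_of S \<Longrightarrow> F \<in> \<T>"
proof -
  obtain C where C: "\<not> affine_dependent C" "S = convex hull C"
    using assms by (auto simp: polytope_triangulation_def simplicial_complex_def simplex_def)
  then have "vertices_of S = C"
    by (simp add: vertices_of_def extreme_point_of_convex_hull_affine_independent)
  then show "S = convex hull vertices_of S" "\<not> affine_dependent (vertices_of S)"
    using C by auto
qed (use assms in \<open>auto simp: polytope_triangulation_def simplicial_complex_def\<close>)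

text \<open>Containment of all cells in the family identifies the triangulation with it; strict
  minimality identifies the family with the projected envelope.\<close>

lemma regular_triangulationI:
  fixes P :: "'a::euclidean_space set"
  assumes P: "finite (vertices_of P)" "convex hull vertices_of P = P" "P \<noteq> {}"
    and S: "triangulating (vertices_of P) \<S>"
    and T: "polytope_triangulation P \<T>" "\<And>S. S \<in> \<T> \<Longrightarrow> vertices_of S \<in> \<S>"
    and less: "\<And>x l m. barycentric (vertices_of P) x l \<Longrightarrow> barycentric (vertices_of P) x m \<Longrightarrow>
      {v. l v \<noteq> 0} \<in> \<S> \<Longrightarrow> l \<noteq> m \<Longrightarrow> (\<Sum>v\<in>vertices_of P. l v * w v) < (\<Sum>v\<in>vertices_of P. m v * w v)"
  shows "regular_triangulation P \<T>"
proof -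
  have "\<T> = projected_lower_envelope (vertices_of P) w"
    by (rule trans[OF polytope_triangulation_eq[OF S P T] projected_lower_envelope_eq[OF S P(1) less, symmetric]])
  then show ?thesis
    using T(1) by (auto simp: regular_triangulation_def regular_over_def)
qed

text \<open>With unique coordinates the family of all subsets is triangulating, and the zero weight
  induces it because the strictness condition is vacuous.\<close>

lemma regular_triangulation_simplex:
  fixes P :: "'a::euclidean_space set"
  assumes P: "finite (vertices_of P)" "convex hull vertices_of P = P" "P \<noteq> {}"
    and indep: "\<not> affine_dependent (vertices_of P)" and T: "polytope_triangulation P \<T>"
  shows "regular_triangulation P \<T>"
proof -
  have unique: "l = m" if "barycentric (vertices_of P) x l" "barycentric (vertices_of P) x m" for x l m
    using indep affine_independent_barycentric[OF P(1)] that by blast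
  have "triangulating (vertices_of P) (Pow (vertices_of P))"
  proof (rule triangulatingI[OF P(1)])
    show "\<exists>m. barycentric (vertices_of P) x m \<and> {v. m v \<noteq> 0} \<in> Pow (vertices_of P)"
      if "barycentric (vertices_of P) x l" for x l
      using that by (intro exI[of _ l]) (simp add: barycentric_def)
    show "l = m" if "barycentric (vertices_of P) x l" "barycentric (vertices_of P) x m" for x l m
      using unique that .
  qed auto
  then show ?thesis
  proof (rule regular_triangulationI[OF P _ T])
    show "vertices_of S \<in> Pow (vertices_of P)" if "S \<in> \<T>" for S
      using polytope_triangulation_cell(3)[OF T that] by simp
    show "(\<Sum>v\<in>vertices_of P. l v * 0) < (\<Sum>v\<in>vertices_of P. m v * 0)"
      if "barycentric (vertices_of P) x l" "barycentric (vertices_of P) x m" "l \<noteq> m" for x and l m :: "'a \<Rightarrow> real"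
      using unique that by blast
  qed
qed

text \<open>The vertices form a single circuit with coefficients 1 on \<open>E\<close> and -1 on
  \<open>D\<close>, so the two parts share their centroid. Such a configuration has two
  triangulations, according to which part is a cell.\<close>

locale circuit_polytope =
  fixes P E D :: "'a::euclidean_space set"
  assumes fin: "finite E" "finite D" and disj: "E \<inter> D = {}" and ne: "E \<noteq> {}" and card: "card E = card D"
    and verts: "vertices_of P = E \<union> D" and hull: "convex hull vertices_of P = P"
    and sum_eq: "\<Sum>E = \<Sum>D"
    and dependency: "\<And>u. (\<Sum>v\<in>E \<union> D. u v *\<^sub>R v) = 0 \<Longrightarrow> \<exists>s. (\<forall>v\<in>E. u v = s) \<and> (\<forall>v\<in>D. u v = - s)"
begin

text \<open>The symmetry allows whichever part occurs as a cell to be called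
  \<open>E\<close>.\<close>

lemma swap: "circuit_polytope P D E"
proof
  show "\<exists>s. (\<forall>v\<in>D. u v = s) \<and> (\<forall>v\<in>E. u v = - s)" if "(\<Sum>v\<in>D \<union> E. u v *\<^sub>R v) = 0" for u
  proof -
    have "(\<Sum>v\<in>E \<union> D. u v *\<^sub>R v) = 0"
      using that by (simp only: Un_commute)
    then obtain s where "\<forall>v\<in>E. u v = s" "\<forall>v\<in>D. u v = - s"
      using dependency by blast
    then show ?thesis by (intro exI[of _ "- s"]) simp
  qed
  show "D \<noteq> {}" using ne card fin by auto
qed (use fin disj card verts hull sum_eq in auto)

abbreviation "V \<equiv> vertices_of P"

lemma finite_V: "finite V"
  using fin by (simp add: verts)

lemma D_ne: "D \<noteq> {}"
  using ne card fin by auto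

lemma barycentric_diff:
  assumes "barycentric V x l" "barycentric V x m"
  obtains s where "\<forall>v\<in>E. l v = m v + s" "\<forall>v\<in>D. l v = m v - s"
proof -
  have "(\<Sum>v\<in>E \<union> D. (l v - m v) *\<^sub>R v) = 0"
    using assms unfolding verts barycentric_def by (simp add: scaleR_diff_left sum_subtractf)
  then obtain s where "\<forall>v\<in>E. l v - m v = s" "\<forall>v\<in>D. l v - m v = - s"
    using dependency[of "\<lambda>v. l v - m v"] by blast
  then show ?thesis
    by (intro that[of s]) (simp_all add: algebra_simps)
qed

text \<open>The triangulation that contains the hull of \<open>E\<close>; each maximal cell omits
  one point of \<open>D\<close>.\<close>

definition cells :: "'a set set" where
  "cells = {W. W \<subseteq> V \<and> \<not> D \<subseteq> W}"

text \<open>Coordinates supported on a cell vanish somewhere on \<open>D\<close>, and there they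
  cannot exceed \<open>m\<close>. The difference is the same at all points of \<open>D\<close>, so
  they are smaller on the whole of \<open>D\<close>.\<close>

lemma cells_diff:
  assumes l: "barycentric V x l" "{v. l v \<noteq> 0} \<in> cells" and m: "barycentric V x m" and "l \<noteq> m"
  obtains s where "0 < s" "\<forall>v\<in>E. l v = m v + s" "\<forall>v\<in>D. l v = m v - s"
proof -
  obtain s where s: "\<forall>v\<in>E. l v = m v + s" "\<forall>v\<in>D. l v = m v - s"
    by (rule barycentric_diff[OF l(1) m])
  obtain d where d: "d \<in> D" "l d = 0"
    using l(2) by (auto simp: cells_def)
  have "0 \<le> m d" using m by (simp add: barycentric_def)
  then have "0 \<le> s" using bspec[OF s(2) d(1)] d(2) by simp
  moreover have "s \<noteq> 0"
  proof
    assume "s = 0"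
    then have eq: "l v = m v" if "v \<in> V" for v
      using s that by (auto simp: verts)
    have "l v = m v" for v
    proof (cases "v \<in> V")
      case False
      then have "l v = 0" "m v = 0"
        using l(1) m unfolding barycentric_def by blast+
      then show ?thesis by simp
    qed (rule eq)
    then show False using \<open>l \<noteq> m\<close> by blast
  qed
  ultimately have "0 < s" by simp
  then show ?thesis using s by (rule that)
qed

lemma triangulating_cells: "triangulating V cells"
proof (rule triangulatingI[OF finite_V])
  show "cells \<subseteq> Pow V" "{} \<in> cells" using D_ne by (auto simp: cells_def)
  show "U \<in> cells" if "W \<in> cells" "U \<subseteq> W" for W U
    using that unfolding cells_def by blast
next
  fix x l assume l: "barycentric V x l"
  \<comment> \<open>Moving along the circuit by the smallest coefficient on \<open>D\<close> makes
    that coefficient zero, keeps the others on \<open>D\<close> nonnegative and increases those on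
    \<open>E\<close>.\<close>
  define s where "s = Min (l ` D)"
  have "s \<in> l ` D"
    unfolding s_def using D_ne fin by (intro Min_in) auto
  then obtain d where d: "d \<in> D" "l d = s" by auto
  have s: "s \<le> l v" if "v \<in> D" for v
    unfolding s_def using fin that by (intro Min_le) auto
  have "0 \<le> s" using d(2) l by (auto simp: barycentric_def)
  define k where "k v = (if v \<in> E then s else if v \<in> D then - s else 0)" for v
  have sums: "(\<Sum>v\<in>V. f v) = (\<Sum>v\<in>E. f v) + (\<Sum>v\<in>D. f v)" for f :: "'a \<Rightarrow> 'b::comm_monoid_add"
    unfolding verts using fin disj by (rule sum.union_disjoint)
  have kE: "k v = s" if "v \<in> E" for v
    using that by (simp add: k_def)
  have kD: "k v = - s" if "v \<in> D" for v
    using that disj by (auto simp: k_def)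
  have "(\<Sum>v\<in>V. k v) = 0"
    unfolding sums using card by (simp add: kE kD)
  moreover have "(\<Sum>v\<in>V. k v *\<^sub>R v) = s *\<^sub>R \<Sum>E - s *\<^sub>R \<Sum>D"
    unfolding sums by (simp add: kE kD scaleR_sum_right sum_negf)
  then have "(\<Sum>v\<in>V. k v *\<^sub>R v) = 0" using sum_eq by simp
  moreover have "0 \<le> l v + k v" for v
    using s \<open>0 \<le> s\<close> l by (auto simp: k_def barycentric_def)
  moreover have "{v. l v + k v \<noteq> 0} \<subseteq> V"
  proof
    fix v assume "v \<in> {v. l v + k v \<noteq> 0}"
    then have "l v \<noteq> 0 \<or> k v \<noteq> 0" by auto
    then show "v \<in> V"
      using l by (auto simp: barycentric_def k_def verts split: if_splits)
  qed
  ultimately have m: "barycentric V x (\<lambda>v. l v + k v)"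
    using l by (simp add: barycentric_def sum.distrib scaleR_add_left)
  moreover have "d \<notin> {v. l v + k v \<noteq> 0}"
    using d kD by simp
  ultimately show "\<exists>m. barycentric V x m \<and> {v. m v \<noteq> 0} \<in> cells"
    using d(1) \<open>{v. l v + k v \<noteq> 0} \<subseteq> V\<close>
    by (intro exI[of _ "\<lambda>v. l v + k v"]) (auto simp: cells_def)
next
  fix x l m
  assume l: "barycentric V x l" "{v. l v \<noteq> 0} \<in> cells" and m: "barycentric V x m" "{v. m v \<noteq> 0} \<in> cells"
  show "l = m"
  proof (rule ccontr)
    assume "l \<noteq> m"
    obtain e where e: "e \<in> D" using D_ne by blast
    obtain s where "0 < s" "l e = m e - s"
      using cells_diff[OF l m(1) \<open>l \<noteq> m\<close>] e by metis
    moreover obtain t where "0 < t" "m e = l e - t"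
      using cells_diff[OF m l(1) \<open>l \<noteq> m\<close>[symmetric]] e by metis
    ultimately show False by simp
  qed
qed

text \<open>A second cell containing \<open>D\<close> would contain the common centroid. Its
  intersection with the hull of \<open>E\<close> is a face of that hull through an inner point,
  hence everything; the cell would then have all of \<open>E\<close> and \<open>D\<close> among its
  vertices, against independence. So the triangulation is \<open>cells\<close>, induced by the
  weight that is 1 on \<open>D\<close> and 0 on \<open>E\<close>.\<close>

lemma regular_if_cell:
  assumes T: "polytope_triangulation P \<T>" and S: "S \<in> \<T>" "E \<subseteq> vertices_of S"
  shows "regular_triangulation P \<T>"
proof (rule regular_triangulationI[OF finite_V hull _ triangulating_cells T])
  show "P \<noteq> {}"
    using hull ne verts by (metis Un_empty convex_hull_eq_empty)
  note cell = polytope_triangulation_cell[OF T]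
  have E_ind: "\<not> affine_dependent E"
    using cell(2)[OF S(1)] S(2) affine_independent_subset by blast
  have "convex hull E face_of convex hull vertices_of S"
    using face_of_convex_hull_affine_independent[OF cell(2)[OF S(1)]] S(2) by blast
  then have ET: "convex hull E \<in> \<T>"
    using cell(1,5)[OF S(1)] by simp
  show "vertices_of S' \<in> cells" if S': "S' \<in> \<T>" for S'
  proof -
    have "\<not> D \<subseteq> vertices_of S'"
    proof
      assume D: "D \<subseteq> vertices_of S'"
      define x where "x = \<Sum>E /\<^sub>R card E"
      have x: "x = \<Sum>D /\<^sub>R card D" unfolding x_def by (simp only: sum_eq card)
      let ?l = "\<lambda>X v. if v \<in> X then 1 / real (card X) else 0"
      have xE: "barycentric V x (?l E)"
        unfolding x_def using barycentric_uniform[OF finite_V _ ne] by (simp add: verts)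
      have xD: "barycentric V x (?l D)"
        unfolding x using barycentric_uniform[OF finite_V _ D_ne] by (simp add: verts)
      have EV: "E \<subseteq> V" and DV: "D \<subseteq> V" by (simp_all add: verts)
      have supp: "{v. ?l X v \<noteq> 0} \<subseteq> X" for X by auto
      have cardne: "card E \<noteq> 0" "card D \<noteq> 0" using fin ne D_ne by auto
      have V': "vertices_of S' \<subseteq> V" "finite (vertices_of S')"
        using cell(3)[OF S'] finite_subset finite_V by blast+
      have "x \<in> convex hull D"
        unfolding convex_hull_barycentric_subset[OF finite_V DV] by (intro exI[of _ "?l D"] conjI xD supp)
      then have "x \<in> S'"
        using cell(1)[OF S'] hull_mono[OF D, of convex] by blast
      moreover have xhE: "x \<in> convex hull E"
        unfolding convex_hull_barycentric_subset[OF finite_V EV] by (intro exI[of _ "?l E"] conjI xE supp)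
      moreover have "convex hull E \<inter> S' face_of convex hull E"
        using T ET S' by (auto simp: polytope_triangulation_def simplicial_complex_def)
      then obtain E' where E': "E' \<subseteq> E" "convex hull E \<inter> S' = convex hull E'"
        using face_of_convex_hull_affine_independent[OF E_ind] by blast
      ultimately have "x \<in> convex hull E'" by blast
      then obtain l where l: "barycentric E x l" "{v. l v \<noteq> 0} \<subseteq> E'"
        using convex_hull_barycentric_subset[OF fin(1) E'(1)] by blast
      have "barycentric E x (?l E)"
        unfolding x_def by (rule barycentric_uniform[OF fin(1) subset_refl ne])
      \<comment> \<open>The centroid has positive weight on every point of \<open>E\<close>, so a
        face of the hull of \<open>E\<close> containing it has all of \<open>E\<close> as
        vertices.\<close>
      then have "l = ?l E"
        using l(1) E_ind affine_independent_barycentric[OF fin(1)] by blast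
      then have "E \<subseteq> E'"
        using l(2) cardne by auto
      then have "E \<subseteq> S'"
        using E'(2) hull_subset[of E convex] hull_mono[of E E' convex] by blast
      have "E \<subseteq> vertices_of S'"
      proof
        fix v assume "v \<in> E"
        then have "v extreme_point_of P" "v \<in> S'"
          using verts \<open>E \<subseteq> S'\<close> by (auto simp: vertices_of_def)
        then show "v \<in> vertices_of S'"
          using cell(4)[OF S'] by (auto simp: vertices_of_def extreme_point_of_def)
      qed
      then have "barycentric (vertices_of S') x (?l E)"
        using iffD2[OF barycentric_superset[OF finite_V V'(1) subset_trans[OF supp]] xE] by blast
      moreover have "barycentric (vertices_of S') x (?l D)"
        by (rule iffD2[OF barycentric_superset[OF finite_V V'(1) subset_trans[OF supp D]] xD])
      ultimately have "?l E = ?l D"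
        using cell(2)[OF S'] affine_independent_barycentric[OF V'(2)] by blast
      moreover obtain e where "e \<in> E" using ne by blast
      moreover have "e \<notin> D" using \<open>e \<in> E\<close> disj by blast
      ultimately show False
        using cardne fun_cong[of "?l E" "?l D" e] by simp
    qed
    then show ?thesis
      using cell(3)[OF S'] by (simp add: cells_def)
  qed
  show "(\<Sum>v\<in>V. l v * indicat_real D v) < (\<Sum>v\<in>V. m v * indicat_real D v)"
    if l: "barycentric V x l" and m: "barycentric V x m" and lc: "{v. l v \<noteq> 0} \<in> cells" and "l \<noteq> m" for x l m
  proof -
    obtain s where s: "0 < s" "\<forall>v\<in>D. l v = m v - s"
      using cells_diff[OF l lc m \<open>l \<noteq> m\<close>] by metis
    have ind: "(\<Sum>v\<in>V. f v * indicat_real D v) = (\<Sum>v\<in>D. f v)" for f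
      using finite_V by (simp add: verts sum.inter_restrict[symmetric] indicator_def if_distrib Int_absorb1 cong: if_cong)
    show ?thesis
      unfolding ind using s fin D_ne by (intro sum_strict_mono) auto
  qed
qed

text \<open>A cell through the common centroid contains \<open>E\<close> or \<open>D\<close>. Its
  coordinates there are the uniform ones on \<open>E\<close> shifted by \<open>s\<close> on
  \<open>E\<close> and by \<open>- s\<close> on \<open>D\<close>; a zero in \<open>D\<close> gives
  \<open>s = 0\<close>, and then there is no zero in \<open>E\<close>.\<close>

lemma regular:
  assumes T: "polytope_triangulation P \<T>"
  shows "regular_triangulation P \<T>"
proof -
  interpret swapped: circuit_polytope P D E by (rule swap)
  define x where "x = \<Sum>E /\<^sub>R card E"
  let ?l = "\<lambda>v. if v \<in> E then 1 / real (card E) else 0"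
  have xE: "barycentric V x ?l"
    unfolding x_def using barycentric_uniform[OF finite_V _ ne] by (simp add: verts)
  then have "x \<in> P"
    using convex_hull_barycentric[OF finite_V] hull by blast
  then obtain S where S: "S \<in> \<T>" "x \<in> S"
    using T by (auto simp: polytope_triangulation_def)
  note cell = polytope_triangulation_cell[OF T S(1)]
  obtain m where m: "barycentric V x m" "{v. m v \<noteq> 0} \<subseteq> vertices_of S"
    using S(2) cell(1,3) convex_hull_barycentric_subset[OF finite_V] by blast
  obtain s where s: "\<forall>v\<in>E. m v = ?l v + s" "\<forall>v\<in>D. m v = ?l v - s"
    by (rule barycentric_diff[OF m(1) xE])
  have "E \<subseteq> vertices_of S \<or> D \<subseteq> vertices_of S"
  proof (rule ccontr)
    assume "\<not> ?thesis"
    then obtain e d where ed: "e \<in> E" "m e = 0" "d \<in> D" "m d = 0"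
      using m(2) by blast
    moreover have "d \<notin> E" using ed(3) disj by blast
    ultimately have "1 / real (card E) = 0"
      using bspec[OF s(1) ed(1)] bspec[OF s(2) ed(3)] ed by simp
    then show False using fin ne by simp
  qed
  then show ?thesis
    using regular_if_cell[OF T S(1)] swapped.regular_if_cell[OF T S(1)] by blast
qed

end

section \<open>Birkhoff polytopes of sizes one, two and three\<close>

lemma vertices_of_birkhoff_eq:
  assumes "X \<subseteq> vertices_of birkhoff_polytope" "(birkhoff_polytope :: (real ^ 'p ^ 'p) set) \<subseteq> convex hull X"
  shows "vertices_of birkhoff_polytope = X"
proof
  have "convex hull X \<subseteq> convex hull vertices_of birkhoff_polytope"
    by (rule hull_mono[OF assms(1)])
  then have "convex hull X = (birkhoff_polytope :: (real ^ 'p ^ 'p) set)"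
    using assms(2) convex_hull_vertices_polytope[OF polytope_birkhoff] by blast
  then show "vertices_of birkhoff_polytope \<subseteq> X"
    using extreme_points_of_convex_hull[of X] by (simp add: vertices_of_def)
qed (rule assms(1))

lemma birkhoff_nonempty: "(birkhoff_polytope :: (real ^ 'p ^ 'p) set) \<noteq> {}"
  using permutation_matrix_vertex[OF bij_id] by (auto simp: vertices_of_def extreme_point_of_def)

lemma birkhoff_regular_at_most_two_vertices:
  assumes "vertices_of birkhoff_polytope \<subseteq> {X, Y :: real ^ 'p ^ 'p}"
    and T: "polytope_triangulation birkhoff_polytope \<T>"
  shows "regular_triangulation (birkhoff_polytope :: (real ^ 'p ^ 'p) set) \<T>"
proof (rule regular_triangulation_simplex[OF _ _ birkhoff_nonempty _ T])
  show "\<not> affine_dependent (vertices_of (birkhoff_polytope :: (real ^ 'p ^ 'p) set))"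
    using affine_independent_subset[OF affine_independent_2 assms(1)] .
qed (simp_all add: finite_vertices_polytope convex_hull_vertices_polytope polytope_birkhoff)

lemma birkhoff_regular_1:
  assumes "CARD('p::finite) = 1"
    and T: "polytope_triangulation birkhoff_polytope \<T>"
  shows "regular_triangulation (birkhoff_polytope :: (real ^ 'p ^ 'p) set) \<T>"
proof -
  obtain e :: 'p where e: "UNIV = {e}"
    using assms(1) by (rule card_1_singletonE)
  have all: "i = e" for i using e by auto
  let ?I = "permutation_matrix id :: real ^ 'p ^ 'p"
  have "B = ?I" if "B \<in> birkhoff_polytope" for B
  proof -
    have "B $ e $ e = 1"
      using that unfolding birkhoff_polytope_def e by simp
    then have "B $ i $ j = ?I $ i $ j" for i j
      by (simp add: all[of i] all[of j] permutation_matrix_def)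
    then show ?thesis
      unfolding vec_eq_iff by blast
  qed
  then have "vertices_of birkhoff_polytope \<subseteq> {?I, ?I}"
    by (auto simp: vertices_of_def extreme_point_of_def)
  then show ?thesis
    by (rule birkhoff_regular_at_most_two_vertices[OF _ T])
qed

lemma birkhoff_regular_2:
  assumes "CARD('p::finite) = 2"
    and T: "polytope_triangulation birkhoff_polytope \<T>"
  shows "regular_triangulation (birkhoff_polytope :: (real ^ 'p ^ 'p) set) \<T>"
proof -
  obtain a b :: 'p where ab: "UNIV = {a, b}" "a \<noteq> b"
    using assms(1) unfolding card_2_iff by blast
  have all: "i = a \<or> i = b" for i using ab by auto
  let ?I = "permutation_matrix id" and ?J = "permutation_matrix (id(a := b, b := a))"
  have "B \<in> convex hull {?I, ?J}" if B: "B \<in> birkhoff_polytope" for B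
  proof -
    have sums: "B $ a $ a + B $ a $ b = 1" "B $ b $ a + B $ b $ b = 1" "B $ a $ a + B $ b $ a = 1"
      using B ab(2) unfolding birkhoff_polytope_def ab(1) by simp_all
    have "B $ i $ j = (B $ a $ a *\<^sub>R ?I + B $ a $ b *\<^sub>R ?J) $ i $ j" for i j
      using all[of i] all[of j] ab(2) sums by (auto simp: permutation_matrix_def)
    then have "B = B $ a $ a *\<^sub>R ?I + B $ a $ b *\<^sub>R ?J"
      unfolding vec_eq_iff by blast
    moreover have "0 \<le> B $ a $ a" "0 \<le> B $ a $ b"
      using B by (simp_all add: birkhoff_polytope_def)
    ultimately show ?thesis
      unfolding convex_hull_2 using sums(1) by blast
  qed
  moreover have "surj (id(a := b, b := a))"
  proof -
    have "(id(a := b, b := a)) ((id(a := b, b := a)) y) = y" for y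
      using all[of y] ab(2) by auto
    then show ?thesis by (rule surjI)
  qed
  then have "bij (id(a := b, b := a))"
    by (simp add: bij_def finite_UNIV_surj_inj)
  then have "{?I, ?J} \<subseteq> vertices_of birkhoff_polytope"
    using permutation_matrix_vertex[OF bij_id] permutation_matrix_vertex by blast
  ultimately have "vertices_of birkhoff_polytope = {?I, ?J}"
    by (intro vertices_of_birkhoff_eq) auto
  then show ?thesis
    by (intro birkhoff_regular_at_most_two_vertices[OF _ T, of ?I ?J]) simp
qed

lemma birkhoff_regular_3:
  assumes "CARD('p::finite) = 3"
    and T: "polytope_triangulation birkhoff_polytope \<T>"
  shows "regular_triangulation (birkhoff_polytope :: (real ^ 'p ^ 'p) set) \<T>"
proof -
  obtain e1 e2 e3 :: 'p where e: "UNIV = {e1, e2, e3}" and dist: "e1 \<noteq> e2" "e2 \<noteq> e3" "e1 \<noteq> e3"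
    using assms(1) unfolding card_3_iff by blast
  have ne: "e1 \<noteq> e2" "e2 \<noteq> e3" "e1 \<noteq> e3" "e2 \<noteq> e1" "e3 \<noteq> e2" "e3 \<noteq> e1"
    using dist by auto
  define M where "M i j k = permutation_matrix (id(e1 := i, e2 := j, e3 := k))" for i j k
  have M: "M i j k $ e1 $ x = (if i = x then 1 else 0)" "M i j k $ e2 $ x = (if j = x then 1 else 0)"
    "M i j k $ e3 $ x = (if k = x then 1 else 0)" for i j k x
    using ne by (auto simp: M_def permutation_matrix_def)
  have vertex: "M i j k \<in> vertices_of birkhoff_polytope" if "{i, j, k} = {e1, e2, e3}" for i j k
  proof -
    let ?f = "id(e1 := i, e2 := j, e3 := k)"
    have "\<exists>x. ?f x = y" for y
    proof -
      have "y \<in> {i, j, k}" using e that by auto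
      then consider "y = i" | "y = j" | "y = k" by blast
      then show ?thesis
      proof cases
        case 1 then show ?thesis using ne by (intro exI[of _ e1]) simp
      next
        case 2 then show ?thesis using ne by (intro exI[of _ e2]) simp
      next
        case 3 then show ?thesis by (intro exI[of _ e3]) simp
      qed
    qed
    then have "surj ?f" by (metis surjI)
    then have "bij ?f" by (simp add: bij_def finite_UNIV_surj_inj)
    then show ?thesis unfolding M_def by (rule permutation_matrix_vertex)
  qed
  have eqI: "X = Y" if "X $ e1 $ e1 = Y $ e1 $ e1" "X $ e1 $ e2 = Y $ e1 $ e2" "X $ e1 $ e3 = Y $ e1 $ e3"
    "X $ e2 $ e1 = Y $ e2 $ e1" "X $ e2 $ e2 = Y $ e2 $ e2" "X $ e2 $ e3 = Y $ e2 $ e3"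
    "X $ e3 $ e1 = Y $ e3 $ e1" "X $ e3 $ e2 = Y $ e3 $ e2" "X $ e3 $ e3 = Y $ e3 $ e3" for X Y :: "real ^ 'p ^ 'p"
  proof -
    have "\<forall>i\<in>UNIV. \<forall>j\<in>UNIV. X $ i $ j = Y $ i $ j"
      unfolding e using that by simp
    then show ?thesis by (simp add: vec_eq_iff)
  qed
  \<comment> \<open>The \<open>E\<close> matrices come from the even permutations, the
    \<open>D\<close> matrices from the odd ones.\<close>
  let ?E1 = "M e1 e2 e3" and ?E2 = "M e2 e3 e1" and ?E3 = "M e3 e1 e2"
  let ?D1 = "M e1 e3 e2" and ?D2 = "M e2 e1 e3" and ?D3 = "M e3 e2 e1"
  let ?L = "[?E1, ?E2, ?E3, ?D1, ?D2, ?D3]"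
  have "distinct (map (\<lambda>N. (N $ e1 $ e1, N $ e1 $ e2, N $ e2 $ e1, N $ e2 $ e2)) ?L)"
    by (simp add: M ne)
  then have distinct: "distinct ?L" by (rule distinct_map[THEN iffD1, THEN conjunct1])
  have sums: "sum f (set ?L) = f ?E1 + f ?E2 + f ?E3 + f ?D1 + f ?D2 + f ?D3"
    for f :: "real ^ 'p ^ 'p \<Rightarrow> 'b::comm_monoid_add"
    using distinct by (simp add: add.assoc)
  let ?V = "vertices_of (birkhoff_polytope :: (real ^ 'p ^ 'p) set)"
  have V: "?V = set ?L"
  proof (rule vertices_of_birkhoff_eq)
    show "set ?L \<subseteq> ?V"
      unfolding list.set by (intro insert_subsetI empty_subsetI vertex) auto
    show "birkhoff_polytope \<subseteq> convex hull (set ?L)"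
    proof
      fix B :: "real ^ 'p ^ 'p" assume B: "B \<in> birkhoff_polytope"
      have rows: "B $ i $ e1 + B $ i $ e2 + B $ i $ e3 = 1" and cols: "B $ e1 $ i + B $ e2 $ i + B $ e3 $ i = 1" for i
        using B ne unfolding birkhoff_polytope_def e by (simp_all add: add.assoc)
      have nonneg: "0 \<le> B $ i $ j" for i j
        using B by (simp add: birkhoff_polytope_def)
      \<comment> \<open>\<open>c\<close> is the weight of the identity. Each diagonal entry is the
        sum of \<open>c\<close> and the weight of the one transposition fixing that index, so
        \<open>c\<close> can be at most the least diagonal entry; this largest choice also keeps the
        weights of the two 3-cycles nonnegative.\<close>
      define c where "c = min (B $ e1 $ e1) (min (B $ e2 $ e2) (B $ e3 $ e3))"
      define u where "u N = (if N = ?E1 then c else if N = ?E2 then B $ e1 $ e2 - B $ e3 $ e3 + c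
        else if N = ?E3 then B $ e1 $ e3 - B $ e2 $ e2 + c else if N = ?D1 then B $ e1 $ e1 - c
        else if N = ?D2 then B $ e3 $ e3 - c else B $ e2 $ e2 - c)" for N
      have u: "u ?E1 = c" "u ?E2 = B $ e1 $ e2 - B $ e3 $ e3 + c" "u ?E3 = B $ e1 $ e3 - B $ e2 $ e2 + c"
        "u ?D1 = B $ e1 $ e1 - c" "u ?D2 = B $ e3 $ e3 - c" "u ?D3 = B $ e2 $ e2 - c"
        using distinct by (auto simp: u_def)
      note facts = rows[of e1] rows[of e2] rows[of e3] cols[of e1] cols[of e2] cols[of e3]
      have "0 \<le> c" using nonneg by (simp add: c_def)
      moreover have "0 \<le> B $ e1 $ e2 - B $ e3 $ e3 + c" "0 \<le> B $ e1 $ e3 - B $ e2 $ e2 + c"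
        using facts nonneg[of e1 e2] nonneg[of e1 e3] nonneg[of e2 e3] nonneg[of e3 e2] nonneg[of e3 e1]
          nonneg[of e2 e1] nonneg[of e1 e1] nonneg[of e2 e2] nonneg[of e3 e3]
        unfolding c_def by linarith+
      moreover have "c \<le> B $ e1 $ e1" "c \<le> B $ e2 $ e2" "c \<le> B $ e3 $ e3" by (simp_all add: c_def)
      ultimately have "\<forall>N\<in>set ?L. 0 \<le> u N" by (simp add: u)
      moreover have "sum u (set ?L) = 1"
        unfolding sums u using facts by linarith
      moreover have "(\<Sum>N\<in>set ?L. u N *\<^sub>R N) = B"
        unfolding sums u by (rule eqI; simp add: M ne; use facts in linarith)
      ultimately show "B \<in> convex hull (set ?L)"
        unfolding convex_hull_finite[OF finite_set] by blast
    qed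
  qed
  interpret circuit_polytope "birkhoff_polytope :: (real ^ 'p ^ 'p) set" "{?E1, ?E2, ?E3}" "{?D1, ?D2, ?D3}"
  proof
    show "{?E1, ?E2, ?E3} \<inter> {?D1, ?D2, ?D3} = {}" using distinct by auto
    show "card {?E1, ?E2, ?E3} = card {?D1, ?D2, ?D3}" using distinct by simp
    show "?V = {?E1, ?E2, ?E3} \<union> {?D1, ?D2, ?D3}" unfolding V by auto
    have "?E1 + (?E2 + ?E3) = ?D1 + (?D2 + ?D3)"
      by (rule eqI; simp add: M ne)
    then show "\<Sum>{?E1, ?E2, ?E3} = \<Sum>{?D1, ?D2, ?D3}" using distinct by simp
    fix u :: "real ^ 'p ^ 'p \<Rightarrow> real"
    assume u: "(\<Sum>v\<in>{?E1, ?E2, ?E3} \<union> {?D1, ?D2, ?D3}. u v *\<^sub>R v) = 0"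
    have sum: "u ?E1 *\<^sub>R ?E1 + u ?E2 *\<^sub>R ?E2 + u ?E3 *\<^sub>R ?E3 + u ?D1 *\<^sub>R ?D1 + u ?D2 *\<^sub>R ?D2 + u ?D3 *\<^sub>R ?D3 = 0"
    proof -
      have "{?E1, ?E2, ?E3} \<union> {?D1, ?D2, ?D3} = set ?L" by auto
      then show ?thesis using u sums[of "\<lambda>v. u v *\<^sub>R v"] by simp
    qed
    have E: "u ?E1 * ?E1 $ i $ j + u ?E2 * ?E2 $ i $ j + u ?E3 * ?E3 $ i $ j
      + u ?D1 * ?D1 $ i $ j + u ?D2 * ?D2 $ i $ j + u ?D3 * ?D3 $ i $ j = 0" for i j
      using arg_cong[OF sum, of "\<lambda>N. N $ i $ j"]
      by (simp only: vector_add_component vector_scaleR_component real_scaleR_def zero_index)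
    \<comment> \<open>Each entry is 1 in exactly one even and one odd matrix, so it makes two
      coefficients opposite; five entries link all six matrices.\<close>
    have "u ?E1 + u ?D1 = 0" "u ?E2 + u ?D2 = 0" "u ?E3 + u ?D3 = 0" "u ?E1 + u ?D3 = 0" "u ?E3 + u ?D2 = 0"
      using E[of e1 e1] E[of e1 e2] E[of e1 e3] E[of e2 e2] E[of e2 e1] by (simp_all add: M ne)
    then have "u ?E2 = u ?E1" "u ?E3 = u ?E1" "u ?D1 = - u ?E1" "u ?D2 = - u ?E1" "u ?D3 = - u ?E1"
      by linarith+
    then show "\<exists>s. (\<forall>v\<in>{?E1, ?E2, ?E3}. u v = s) \<and> (\<forall>v\<in>{?D1, ?D2, ?D3}. u v = - s)"
      by (intro exI[of _ "u ?E1"]) simp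
  qed (simp_all add: convex_hull_vertices_polytope polytope_birkhoff)
  show ?thesis
    by (rule regular[OF T])
qed

theorem theorem3p15:
  shows "(CARD('p::finite) \<ge> 4 \<longrightarrow>
           (\<exists>\<T>. polytope_triangulation (birkhoff_polytope :: (real ^ 'p ^ 'p) set) \<T> \<and>
                \<not> regular_triangulation (birkhoff_polytope :: (real ^ 'p ^ 'p) set) \<T>)) \<and>
         (CARD('p) < 4 \<longrightarrow>
           (\<forall>\<T>. polytope_triangulation (birkhoff_polytope :: (real ^ 'p ^ 'p) set) \<T> \<longrightarrow>
                regular_triangulation (birkhoff_polytope :: (real ^ 'p ^ 'p) set) \<T>))"
proof (intro conjI impI allI)
  fix \<T> :: "(real ^ 'p ^ 'p) set set"
  assume "CARD('p) < 4" and T: "polytope_triangulation birkhoff_polytope \<T>"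
  moreover have "0 < CARD('p)" by simp
  ultimately consider "CARD('p) = 1" | "CARD('p) = 2" | "CARD('p) = 3" by linarith
  then show "regular_triangulation birkhoff_polytope \<T>"
    using birkhoff_regular_1[OF _ T] birkhoff_regular_2[OF _ T] birkhoff_regular_3[OF _ T] by cases
qed (rule birkhoff_exists_nonregular)

end
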